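(* Let $R\subset\mathbb{N}$ be a sublacunary good set. Let $\alpha$ be an irrational number, and let the Borel probability measure $\nu$ on $\mathbb{T}$ be absolutely continuous with respect to $\mu_{R,\alpha}$. Then there is a good set $S\subset R$ which represents $\nu$ at $\alpha$, that is, $\mu_{S,\alpha}=\nu$.
   Context: $\mathbb{N}=\{1,2,3,\dots\}$, $\mathbb{T}=\mathbb{R}/\mathbb{Z}$ and $e(\beta)=e^{2\pi i\beta}$. A good set $S\subset\mathbb{N}$ is an infinite set of positive integers which, when listed in increasing order as $s_1<s_2<\dots$, has the property that $\lim_{N\to\infty}\frac1N\sum_{n=1}^N e(s_n\beta)$ exists for every real number $\beta$. For a good set $S$ and every $\beta\in\mathbb{T}$, the weak limit of probability measures $\mu_{S,\beta}:=\lim_{N\to\infty}\frac1N\sum_{n=1}^N\delta_{s_n\beta}$ on $\mathbb{T}$ exists (with $s_n\beta$ taken mod $1$). For $R\subset\mathbb{N}$ write $R(N)=R\cap[1,N]$. The set $R$ is called sublacunary if $\lim_{N\to\infty}\frac{\#R(N)}{\log N}=\infty$. *)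

theory Defs
  imports "HOL-Probability.Probability"
begin

section \<open>The circle group \<open>\<real>/\<int>\<close>\<close>

definition cong_ints :: "real \<Rightarrow> real \<Rightarrow> bool"
  where "cong_ints x y \<longleftrightarrow> x - y \<in> \<int>"

lemma equivp_cong_ints: "equivp cong_ints"
proof (rule equivpI)
  show "reflp cong_ints"
    by (simp add: reflp_def cong_ints_def)
  show "symp cong_ints"
    unfolding symp_def cong_ints_def by (metis Ints_minus minus_diff_eq)
  show "transp cong_ints"
    unfolding transp_def cong_ints_def by (metis Ints_add diff_add_cancel add_diff_eq)
qed

quotient_type circle = real / cong_ints
  by (rule equivp_cong_ints)

lift_definition to_circle :: "real \<Rightarrow> circle" is "\<lambda>x. x" .

text \<open>The quotient topology; the type class then provides \<open>borel :: circle measure\<close>.\<close>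

instantiation circle :: topological_space
begin

definition open_circle :: "circle set \<Rightarrow> bool"
  where "open_circle U \<longleftrightarrow> open (to_circle -` U)"

instance
proof
  fix K :: "circle set set"
  assume "\<forall>U\<in>K. open U"
  moreover have "to_circle -` \<Union>K = (\<Union>U\<in>K. to_circle -` U)"
    by auto
  ultimately show "open (\<Union>K)"
    by (auto simp: open_circle_def)
qed (auto simp: open_circle_def)

end

section \<open>Good sets and their limit measures\<close>

definition echar :: "real \<Rightarrow> complex"
  where "echar \<beta> = exp (2 * of_real pi * \<i> * of_real \<beta>)"

text \<open>
  The type \<^typ>\<open>nat\<close> contains 0, hence the condition \<open>0 \<notin> S\<close>.  The library function
  \<^const>\<open>enumerate\<close> lists an infinite set increasingly starting with index 0, so
  \<open>enumerate S n\<close> is \<open>s\<^sub>n\<^sub>+\<^sub>1\<close>.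
\<close>

definition good_set :: "nat set \<Rightarrow> bool"
  where "good_set S \<longleftrightarrow> infinite S \<and> 0 \<notin> S \<and>
    (\<forall>\<beta>::real. convergent (\<lambda>N::nat. (\<Sum>n<N. echar (real (enumerate S n) * \<beta>)) / of_nat N))"

definition sublacunary :: "nat set \<Rightarrow> bool"
  where "sublacunary R \<longleftrightarrow>
    filterlim (\<lambda>N::nat. real (card (R \<inter> {1..N})) / ln (real N)) at_top sequentially"

text \<open>
  The image under \<open>n \<mapsto> s\<^sub>n \<beta>\<close> mod 1 of the uniform distribution on the first \<open>N\<close> indices,
  i.e. \<open>1/N\<close> times the sum of the point masses at these points.
\<close>

definition empirical :: "nat set \<Rightarrow> real \<Rightarrow> nat \<Rightarrow> circle measure"
  where "empirical S \<beta> N =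
    distr (uniform_count_measure {..<N}) borel (\<lambda>n. to_circle (real (enumerate S n) * \<beta>))"

definition weak_limit :: "(nat \<Rightarrow> circle measure) \<Rightarrow> circle measure \<Rightarrow> bool"
  where "weak_limit M \<mu> \<longleftrightarrow> (\<forall>f :: circle \<Rightarrow> real. continuous_on UNIV f \<longrightarrow>
    (\<lambda>N. \<integral>x. f x \<partial>M N) \<longlonglongrightarrow> (\<integral>x. f x \<partial>\<mu>))"

definition mu :: "nat set \<Rightarrow> real \<Rightarrow> circle measure"
  where "mu S \<beta> = (THE \<mu>. prob_space \<mu> \<and> sets \<mu> = sets borel \<and> weak_limit (empirical S \<beta>) \<mu>)"

section \<open>Existence and uniqueness of the limit measure of a good set\<close>

text \<open>The theorem \<open>mu_limit\<close> below shows that the description operator in \<open>mu\<close> is well-defined on good sets.\<close>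

lemma to_circle_eq_iff: "to_circle x = to_circle y \<longleftrightarrow> x - y \<in> \<int>"
  by transfer (simp add: cong_ints_def)

lemma to_circle_surj: obtains x where "a = to_circle x" "0 \<le> x" "x < 1"
proof -
  obtain y where y: "a = to_circle y"
    by transfer (use equivp_cong_ints in \<open>auto simp: equivp_def\<close>)
  have "a = to_circle (frac y)"
    unfolding y to_circle_eq_iff by (simp add: frac_def)
  then show thesis
    using that frac_ge_0 frac_lt_1 by blast
qed

lemma continuous_on_circle_iff:
  fixes f :: "circle \<Rightarrow> 'a::topological_space"
  shows "continuous_on UNIV f \<longleftrightarrow> continuous_on UNIV (\<lambda>x. f (to_circle x))"
  by (simp add: continuous_on_open_vimage open_circle_def vimage_def)

lemma continuous_to_circle [continuous_intros]: "continuous_on UNIV to_circle"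
  by (simp add: continuous_on_open_vimage open_circle_def)

lemma measurable_to_circle [measurable]: "to_circle \<in> borel_measurable borel"
  by (intro borel_measurable_continuous_onI continuous_to_circle)

lemma compact_circle: "compact (UNIV :: circle set)"
proof -
  have "to_circle ` {0..1} = UNIV"
    using to_circle_surj by (metis UNIV_eq_I atLeastAtMost_iff image_eqI less_eq_real_def)
  then show ?thesis
    using compact_continuous_image[of "{0..1}" to_circle] continuous_to_circle
    by (metis compact_Icc continuous_on_subset top_greatest)
qed

lemma echar_cis: "echar x = cis (2 * pi * x)"
  by (simp add: echar_def cis_conv_exp mult_ac)

lemma echar_eq_iff: "echar x = echar y \<longleftrightarrow> x - y \<in> \<int>"
proof -
  have "echar x = echar y \<longleftrightarrow> echar (x - y) = 1"
    by (simp add: echar_cis right_diff_distrib flip: cis_divide)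
  also have "\<dots> \<longleftrightarrow> x - y \<in> \<int>"
  proof
    assume "echar (x - y) = 1"
    then obtain n :: int where "2 * pi * (x - y) = of_int (2 * n) * pi"
      unfolding echar_def exp_eq_1 by auto
    then have "pi * (2 * (x - y)) = pi * (2 * of_int n)" by (simp add: mult_ac)
    then have "x - y = of_int n" by (simp only: mult_cancel_left pi_neq_zero) simp
    then show "x - y \<in> \<int>" by simp
  next
    assume "x - y \<in> \<int>"
    then obtain n where "x - y = of_int n" by (auto elim: Ints_cases)
    then show "echar (x - y) = 1" unfolding echar_def exp_eq_1 by auto
  qed
  finally show ?thesis .
qed

lift_definition circ :: "circle \<Rightarrow> complex" is echar
  by (simp add: cong_ints_def echar_eq_iff)

lemma circ_to_circle: "circ (to_circle x) = echar x"
  by transfer simp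

lemma inj_circ: "inj circ"
proof (rule injI)
  fix a b assume "circ a = circ b"
  then show "a = b"
    by transfer (simp add: cong_ints_def echar_eq_iff)
qed

lemma continuous_circ: "continuous_on UNIV circ"
  unfolding continuous_on_circle_iff circ_to_circle echar_def by (intro continuous_intros)

lemma bounded_continuous_circle:
  fixes f :: "circle \<Rightarrow> real"
  assumes "continuous_on UNIV f"
  obtains B where "\<And>x. \<bar>f x\<bar> \<le> B"
proof -
  have "bounded (range f)"
    using assms compact_circle by (intro compact_imp_bounded compact_continuous_image)
  then show thesis
    using that by (auto simp: bounded_iff)
qed

lemma circle_measure_eqI:
  assumes "prob_space \<mu>" "sets \<mu> = sets borel" "prob_space \<nu>" "sets \<nu> = sets borel"
    and eq: "\<And>f :: circle \<Rightarrow> real. continuous_on UNIV f \<Longrightarrow> (\<integral>x. f x \<partial>\<mu>) = (\<integral>x. f x \<partial>\<nu>)"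
  shows "\<mu> = \<nu>"
proof -
  have *: "(\<lambda>n::nat. \<integral>x. max 0 (1 - real n * infdist (circ x) (circ ` C)) \<partial>M) \<longlonglongrightarrow> measure M C"
    if C: "closed C" "C \<noteq> {}" and M: "prob_space M" "sets M = sets (borel :: circle measure)" for C M
  proof -
    interpret prob_space M by fact
    have CM: "C \<in> sets M" "space M = UNIV"
      using C M sets_eq_imp_space_eq[OF M(2)] by auto
    have cl: "closed (circ ` C)"
      using C compact_circle continuous_circ
      by (metis compact_Int_closed compact_continuous_image compact_imp_closed continuous_on_subset
          inf_top_left top_greatest)
    have lim: "(\<lambda>n. max 0 (1 - real n * infdist (circ x) (circ ` C))) \<longlonglongrightarrow> indicator C x" for x
    proof (cases "x \<in> C")
      case True then show ?thesis by simp
    next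
      case False
      then have "circ x \<notin> circ ` C" using inj_circ by (auto simp: inj_def)
      then have d: "infdist (circ x) (circ ` C) > 0" (is "?d > 0")
        using cl C by (simp add: infdist_pos_not_in_closed)
      have "eventually (\<lambda>n. real n > 1 / ?d) sequentially"
        using filterlim_real_sequentially unfolding filterlim_at_top_dense by blast
      then have "eventually (\<lambda>n. max 0 (1 - real n * ?d) = indicator C x) sequentially"
        by eventually_elim (use d False in \<open>auto simp: field_simps\<close>)
      then show ?thesis by (rule tendsto_eventually)
    qed
    have meas: "(\<lambda>x. max 0 (1 - real n * infdist (circ x) (circ ` C))) \<in> borel_measurable M" for n
      unfolding measurable_cong_sets[OF M(2) refl]
      by (intro borel_measurable_continuous_onI continuous_intros continuous_circ)
    have "(\<lambda>n::nat. \<integral>x. max 0 (1 - real n * infdist (circ x) (circ ` C)) \<partial>M) \<longlonglongrightarrow> (\<integral>x. indicator C x \<partial>M)"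
    proof (rule integral_dominated_convergence[where w = "\<lambda>_. 1"])
      show "AE x in M. (\<lambda>n. max 0 (1 - real n * infdist (circ x) (circ ` C))) \<longlonglongrightarrow> indicator C x"
        using lim by simp
      show "AE x in M. norm (max 0 (1 - real n * infdist (circ x) (circ ` C))) \<le> 1" for n :: nat
        by (simp add: infdist_nonneg)
    qed (use CM meas in auto)
    then show ?thesis using CM by simp
  qed
  show ?thesis
  proof (rule measure_eqI_generator_eq[where \<Omega> = UNIV and E = "{C. closed C}" and A = "\<lambda>_. UNIV"])
    fix C :: "circle set" assume "C \<in> {C. closed C}"
    then have C: "closed C" by simp
    interpret M: prob_space \<mu> by fact
    interpret N: prob_space \<nu> by fact
    show "emeasure \<mu> C = emeasure \<nu> C"
    proof (cases "C = {}")
      case False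
      have "(\<integral>x. max 0 (1 - real n * infdist (circ x) (circ ` C)) \<partial>\<mu>) =
            (\<integral>x. max 0 (1 - real n * infdist (circ x) (circ ` C)) \<partial>\<nu>)" for n
        by (intro eq continuous_intros continuous_circ)
      then have "measure \<mu> C = measure \<nu> C"
        using *[OF C False assms(1,2)] *[OF C False assms(3,4)] by (simp add: LIMSEQ_unique)
      then show ?thesis by (simp add: M.emeasure_eq_measure N.emeasure_eq_measure)
    qed simp
  next
    interpret M: prob_space \<mu> by fact
    show "emeasure \<mu> UNIV \<noteq> \<infinity>" by simp
    show "sets \<mu> = sigma_sets UNIV {C. closed C}" "sets \<nu> = sigma_sets UNIV {C. closed C}"
      unfolding assms borel_eq_closed by simp_all
  qed (auto simp: Int_stable_def)
qed

inductive trig :: "(complex \<Rightarrow> complex) \<Rightarrow> bool" where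
  powi: "trig (\<lambda>z. c * z powi k)"
| add: "trig f \<Longrightarrow> trig g \<Longrightarrow> trig (\<lambda>z. f z + g z)"

definition trig1 where "trig1 f \<longleftrightarrow> (\<exists>g. trig g \<and> (\<forall>z. cmod z = 1 \<longrightarrow> complex_of_real (f z) = g z))"

lemma trig_mult_powi: "trig f \<Longrightarrow> \<exists>h. trig h \<and> (\<forall>z. cmod z = 1 \<longrightarrow> h z = c * z powi k * f z)"
proof (induction rule: trig.induct)
  case (powi d l)
  show ?case
  proof (intro exI[of _ "\<lambda>z. (c * d) * z powi (k + l)"] conjI allI impI)
    fix z :: complex assume "cmod z = 1"
    then have "z \<noteq> 0" by auto
    then show "c * d * z powi (k + l) = c * z powi k * (d * z powi l)"
      by (simp add: power_int_add)
  qed (rule trig.powi)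
next
  case (add f g)
  then obtain h h' where "trig h" "trig h'" "\<forall>z. cmod z = 1 \<longrightarrow> h z = c * z powi k * f z"
     "\<forall>z. cmod z = 1 \<longrightarrow> h' z = c * z powi k * g z" by blast
  then show ?case
    by (intro exI[of _ "\<lambda>z. h z + h' z"]) (auto simp: trig.add distrib_left)
qed

lemma trig_mult: "trig f \<Longrightarrow> trig g \<Longrightarrow> \<exists>h. trig h \<and> (\<forall>z. cmod z = 1 \<longrightarrow> h z = f z * g z)"
proof (induction rule: trig.induct)
  case (powi d l)
  show ?case using trig_mult_powi[OF powi] .
next
  case (add f f')
  then obtain h h' where "trig h" "trig h'" "\<forall>z. cmod z = 1 \<longrightarrow> h z = f z * g z"
     "\<forall>z. cmod z = 1 \<longrightarrow> h' z = f' z * g z" by blast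
  then show ?case
    by (intro exI[of _ "\<lambda>z. h z + h' z"]) (auto simp: trig.add distrib_right)
qed

lemma trig1_Re: "trig1 Re" and trig1_Im: "trig1 Im"
proof -
  have "trig (\<lambda>z. (1/2) * z powi 1 + (1/2) * z powi (-1))"
       "trig (\<lambda>z. (-\<i>/2) * z powi 1 + (\<i>/2) * z powi (-1))"
    by (intro trig.intros)+
  moreover have "inverse z = cnj z" if "cmod z = 1" for z
    using that by (metis complex_cnj_one complex_mult_cnj complex_norm_square divide_self_if inverse_unique mult.commute of_real_1 power_one)
  then have "of_real (Re z) = (1/2) * z powi 1 + (1/2) * z powi (-1)"
      "of_real (Im z) = (-\<i>/2) * z powi 1 + (\<i>/2) * z powi (-1)" if "cmod z = 1" for z
    using that by (simp_all add: power_int_minus complex_eq_iff)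
  ultimately show "trig1 Re" "trig1 Im"
    unfolding trig1_def by blast+
qed

lemma trig1_approx:
  assumes f: "continuous_on (sphere 0 1) f" and "0 < \<epsilon>"
  shows "\<exists>g. trig1 g \<and> (\<forall>z\<in>sphere 0 1. \<bar>f z - g z\<bar> < \<epsilon>)"
proof (rule Stone_Weierstrass_HOL[where S = "sphere 0 1" and P = "\<lambda>g. trig1 g \<and> continuous_on (sphere 0 1) g", THEN exE])
  show "compact (sphere (0::complex) 1)" by simp
  show "trig1 (\<lambda>_. c) \<and> continuous_on (sphere 0 1) (\<lambda>_. c)" for c
    using trig.powi[of "of_real c" 0] by (auto simp: trig1_def)
  show "trig1 (\<lambda>x. f x + g x) \<and> continuous_on (sphere 0 1) (\<lambda>x. f x + g x)"
    if "(trig1 f \<and> continuous_on (sphere 0 1) f) \<and> (trig1 g \<and> continuous_on (sphere 0 1) g)" for f g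
    using that by (auto simp: trig1_def intro!: continuous_intros) (metis trig.add of_real_add)
  show "trig1 (\<lambda>x. f x * g x) \<and> continuous_on (sphere 0 1) (\<lambda>x. f x * g x)"
    if fg: "(trig1 f \<and> continuous_on (sphere 0 1) f) \<and> (trig1 g \<and> continuous_on (sphere 0 1) g)" for f g
  proof
    obtain f' g' where *: "trig f'" "trig g'" "\<And>z. cmod z = 1 \<Longrightarrow> of_real (f z) = f' z"
       "\<And>z. cmod z = 1 \<Longrightarrow> of_real (g z) = g' z"
      using fg unfolding trig1_def by blast
    from trig_mult[OF *(1,2)] show "trig1 (\<lambda>x. f x * g x)"
      unfolding trig1_def using * by auto
  qed (use fg in \<open>auto intro!: continuous_intros\<close>)
  show "\<exists>f. (trig1 f \<and> continuous_on (sphere 0 1) f) \<and> f x \<noteq> f y"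
    if "x \<in> sphere 0 1 \<and> y \<in> sphere 0 1 \<and> x \<noteq> y" for x y
  proof -
    have "Re x \<noteq> Re y \<or> Im x \<noteq> Im y" using that complex_eqI by blast
    moreover have "continuous_on (sphere 0 1) Re" "continuous_on (sphere 0 1) Im"
      by (intro continuous_intros)+
    ultimately show ?thesis using trig1_Re trig1_Im by blast
  qed
qed (use assms in auto)

lemma integral_empirical:
  fixes f :: "circle \<Rightarrow> real"
  assumes "continuous_on UNIV f"
  shows "(\<integral>x. f x \<partial>empirical S \<beta> N) = (\<Sum>n<N. f (to_circle (real (enumerate S n) * \<beta>))) / real N"
proof -
  have "f \<in> borel_measurable borel" using assms by (rule borel_measurable_continuous_onI)
  then show ?thesis
    unfolding empirical_def
    by (subst integral_distr) (auto simp: integral_uniform_count_measure measurable_def space_uniform_count_measure sets_uniform_count_measure)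
qed

lemma good_set_convergent_trig:
  assumes "good_set S" "trig g"
  shows "convergent (\<lambda>N. (\<Sum>n<N. g (echar (real (enumerate S n) * \<beta>))) / of_nat N)"
  using assms(2)
proof (induction rule: trig.induct)
  case (powi c k)
  have "echar x powi k = echar (real_of_int k * x)" for x
    unfolding echar_cis by (simp add: cis_power_int mult_ac)
  then have "(\<Sum>n<N. c * echar (real (enumerate S n) * \<beta>) powi k) / of_nat N =
     c * ((\<Sum>n<N. echar (real (enumerate S n) * (real_of_int k * \<beta>))) / of_nat N)" for N
    by (simp add: mult_ac flip: sum_distrib_left)
  moreover have "convergent (\<lambda>N. (\<Sum>n<N. echar (real (enumerate S n) * (real_of_int k * \<beta>))) / of_nat N)"
    using assms(1) unfolding good_set_def by blast
  ultimately show ?case by (simp only: convergent_mult convergent_const)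
next
  case (add f g)
  then show ?case
    using convergent_add by (fastforce simp: sum.distrib add_divide_distrib)
qed

lemma good_set_convergent:
  fixes f :: "circle \<Rightarrow> real"
  assumes S: "good_set S" and f: "continuous_on UNIV f"
  shows "convergent (\<lambda>N. \<integral>x. f x \<partial>empirical S \<beta> N)"
proof -
  define u where "u n = to_circle (real (enumerate S n) * \<beta>)" for n
  define h where "h = f \<circ> inv circ"
  have range: "range circ = sphere 0 1"
  proof
    show "range circ \<subseteq> sphere 0 1"
    proof
      fix z assume "z \<in> range circ"
      then obtain a where "z = circ a" by blast
      moreover obtain x where "a = to_circle x" by (rule to_circle_surj)
      ultimately show "z \<in> sphere 0 1" by (simp add: circ_to_circle echar_cis)
    qed
    show "sphere 0 1 \<subseteq> range circ"
    proof
      fix z :: complex assume "z \<in> sphere 0 1"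
      then have "z = cis (Arg z)"
        using cis_Arg[of z] by (cases "z = 0") (simp_all add: sgn_div_norm)
      then have "z = circ (to_circle (Arg z / (2 * pi)))"
        by (simp add: circ_to_circle echar_cis)
      then show "z \<in> range circ" by blast
    qed
  qed
  have "continuous_on (range circ) (inv circ)"
    by (rule continuous_on_inv[OF continuous_circ compact_circle]) (simp add: inj_circ)
  then have h: "continuous_on (sphere 0 1) h"
    unfolding h_def range using f by (metis continuous_on_compose continuous_on_subset top_greatest)
  have fh: "f x = h (circ x)" for x
    by (simp add: h_def inj_circ)
  have "Cauchy (\<lambda>N. (\<Sum>n<N. f (u n)) / real N)"
  proof (rule metric_CauchyI)
    fix \<epsilon> :: real assume e: "0 < \<epsilon>"
    obtain g where g: "trig1 g" "\<And>z. z \<in> sphere 0 1 \<Longrightarrow> \<bar>h z - g z\<bar> < \<epsilon> / 3"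
      using trig1_approx[OF h, of "\<epsilon> / 3"] e by auto
    obtain g' where g': "trig g'" "\<And>z. cmod z = 1 \<Longrightarrow> of_real (g z) = g' z"
      using g(1) unfolding trig1_def by blast
    define A where "A N = (\<Sum>n<N. g (circ (u n))) / real N" for N
    have "(\<lambda>N. complex_of_real (A N)) = (\<lambda>N. (\<Sum>n<N. g' (echar (real (enumerate S n) * \<beta>))) / of_nat N)"
      by (rule ext) (simp add: A_def u_def circ_to_circle g' echar_cis)
    then have "convergent (\<lambda>N. complex_of_real (A N))"
      using good_set_convergent_trig[OF S g'(1)] by simp
    then have "convergent A"
      unfolding convergent_def by (force dest: tendsto_Re)
    then have "Cauchy A" by (rule convergent_Cauchy)
    then obtain M where M: "\<And>m n. m \<ge> M \<Longrightarrow> n \<ge> M \<Longrightarrow> dist (A m) (A n) < \<epsilon> / 3"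
      using e metric_CauchyD[of A "\<epsilon>/3"] by auto
    have close: "\<bar>(\<Sum>n<N. f (u n)) / real N - A N\<bar> \<le> \<epsilon> / 3" for N
    proof -
      have "\<bar>\<Sum>n<N. f (u n) - g (circ (u n))\<bar> \<le> (\<Sum>n<N. \<bar>f (u n) - g (circ (u n))\<bar>)" by (rule sum_abs)
      also have "\<dots> \<le> (\<Sum>n<N. \<epsilon> / 3)"
      proof (intro sum_mono less_imp_le)
        fix n
        have "circ (u n) \<in> sphere 0 1" using range by blast
        then show "\<bar>f (u n) - g (circ (u n))\<bar> < \<epsilon> / 3" using g(2) fh by simp
      qed
      finally have "\<bar>(\<Sum>n<N. f (u n) - g (circ (u n)))\<bar> \<le> real N * (\<epsilon> / 3)" by simp
      then show ?thesis
        using e by (cases "N = 0")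
          (simp_all add: A_def abs_divide pos_divide_le_eq mult.commute sum_subtractf flip: diff_divide_distrib)
    qed
    show "\<exists>M. \<forall>m\<ge>M. \<forall>n\<ge>M. dist ((\<Sum>n<m. f (u n)) / real m) ((\<Sum>k<n. f (u k)) / real n) < \<epsilon>"
    proof (intro exI allI impI)
      fix m n assume "m \<ge> M" "n \<ge> M"
      from M[OF this] close[of m] close[of n]
      show "dist ((\<Sum>n<m. f (u n)) / real m) ((\<Sum>k<n. f (u k)) / real n) < \<epsilon>"
        unfolding dist_real_def by linarith
    qed
  qed
  then show ?thesis
    unfolding integral_empirical[OF f] u_def by (rule Cauchy_convergent)
qed

lemma ex1_limit_measure:
  assumes S: "good_set S"
  shows "\<exists>!\<mu>. prob_space \<mu> \<and> sets \<mu> = sets borel \<and> weak_limit (empirical S \<beta>) \<mu>"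
proof (rule ex_ex1I)
  define X where "X n = frac (real (enumerate S n) * \<beta>)" for n
  define E where "E N = distr (uniform_count_measure {..<Suc N}) borel X" for N
  have X: "X \<in> uniform_count_measure {..<Suc N} \<rightarrow>\<^sub>M borel" for N
    by (auto simp: measurable_def space_uniform_count_measure sets_uniform_count_measure)
  have tcX: "to_circle (X n) = to_circle (real (enumerate S n) * \<beta>)" for n
    unfolding X_def to_circle_eq_iff by (simp add: frac_def)
  have E: "real_distribution (E N)" for N
  proof -
    have "prob_space (uniform_count_measure {..<Suc N})"
      by (rule prob_space_uniform_count_measure) auto
    then show ?thesis
      unfolding E_def real_distribution_def real_distribution_axioms_def
      using X by (auto intro: prob_space.prob_space_distr)
  qed
  have "measure (E N) {-1<..1} = 1" for N
  proof -
    have "X -` {-1<..1} \<inter> {..<Suc N} = {..<Suc N}"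
      by (auto simp: X_def frac_lt_1 less_imp_le) (smt (verit) frac_ge_0)
    then show ?thesis
      unfolding E_def using X[of N]
      by (simp add: measure_distr measure_uniform_count_measure space_uniform_count_measure)
  qed
  then have "tight E"
    unfolding tight_def using E by (intro conjI allI impI exI[of _ "-1"] exI[of _ 1]) simp_all
  then obtain r M where r: "strict_mono r" "real_distribution M" "weak_conv_m (E \<circ> r) M"
    using tight_imp_convergent_subsubsequence[of E id] by (auto simp: strict_mono_id)
  interpret M: real_distribution M by fact
  define \<mu> where "\<mu> = distr M borel to_circle"
  have "(\<lambda>N. \<integral>x. f x \<partial>empirical S \<beta> N) \<longlonglongrightarrow> (\<integral>x. f x \<partial>\<mu>)"
    if f: "continuous_on UNIV f" for f :: "circle \<Rightarrow> real"
  proof -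
    have fm [measurable]: "f \<in> borel_measurable borel" using f by (rule borel_measurable_continuous_onI)
    obtain B where B: "\<And>x. \<bar>f x\<bar> \<le> B" using bounded_continuous_circle[OF f] by blast
    have cont: "isCont (\<lambda>x. f (to_circle x)) x" for x
      using f unfolding continuous_on_circle_iff continuous_on_eq_continuous_at[OF open_UNIV] by blast
    have "(\<lambda>n. integral\<^sup>L ((E \<circ> r) n) (\<lambda>x. f (to_circle x))) \<longlonglongrightarrow> integral\<^sup>L M (\<lambda>x. f (to_circle x))"
      using E r cont B by (intro weak_conv_imp_integral_bdd_continuous_conv[where B = B]) (auto simp: o_def)
    moreover have "integral\<^sup>L (E n) (\<lambda>x. f (to_circle x)) = (\<integral>x. f x \<partial>empirical S \<beta> (Suc n))" for n
      unfolding integral_empirical[OF f] E_def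
      by (subst integral_distr[OF X]) (simp_all add: integral_uniform_count_measure tcX)
    ultimately have sub: "((\<lambda>N. \<integral>x. f x \<partial>empirical S \<beta> N) \<circ> (\<lambda>n. Suc (r n))) \<longlonglongrightarrow> (\<integral>x. f x \<partial>\<mu>)"
      by (simp add: \<mu>_def integral_distr o_def)
    obtain L where L: "(\<lambda>N. \<integral>x. f x \<partial>empirical S \<beta> N) \<longlonglongrightarrow> L"
      using good_set_convergent[OF S f] unfolding convergent_def by blast
    have "strict_mono (\<lambda>n. Suc (r n))" using r(1) by (simp add: strict_mono_def)
    from LIMSEQ_unique[OF LIMSEQ_subseq_LIMSEQ[OF L this] sub] show ?thesis
      using L by simp
  qed
  moreover have "prob_space \<mu>" unfolding \<mu>_def by (rule M.prob_space_distr) simp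
  ultimately show "\<exists>\<mu>. prob_space \<mu> \<and> sets \<mu> = sets borel \<and> weak_limit (empirical S \<beta>) \<mu>"
    unfolding weak_limit_def by (intro exI[of _ \<mu>]) (simp add: \<mu>_def)
next
  fix \<mu> \<nu>
  assume \<mu>: "prob_space \<mu> \<and> sets \<mu> = sets borel \<and> weak_limit (empirical S \<beta>) \<mu>"
    and \<nu>: "prob_space \<nu> \<and> sets \<nu> = sets borel \<and> weak_limit (empirical S \<beta>) \<nu>"
  have "(\<integral>x. f x \<partial>\<mu>) = (\<integral>x. f x \<partial>\<nu>)" if "continuous_on UNIV f" for f :: "circle \<Rightarrow> real"
    using \<mu> \<nu> that unfolding weak_limit_def by (blast intro: LIMSEQ_unique)
  with \<mu> \<nu> show "\<mu> = \<nu>"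
    by (blast intro: circle_measure_eqI)
qed

theorem mu_limit:
  assumes "good_set S"
  shows "prob_space (mu S \<beta>)" "sets (mu S \<beta>) = sets borel" "weak_limit (empirical S \<beta>) (mu S \<beta>)"
  using theI'[OF ex1_limit_measure[OF assms, of \<beta>]] unfolding mu_def by blast+

end

theory Submission
  imports Defs
begin

text \<open>
  Write \<open>r\<^sub>n\<close> for the \<open>n\<close>-th element of \<open>R\<close>, \<open>\<mu>\<close> for the limit measure of \<open>R\<close> at \<open>\<alpha>\<close>, \<open>x\<^sub>n\<close> for
  \<open>r\<^sub>n \<alpha>\<close> mod 1, and \<open>\<rho>\<close> for the density of \<open>\<nu>\<close> with respect to \<open>\<mu>\<close>.  If \<open>\<rho>\<close> is continuous with
  values in \<open>[0,1]\<close>, one keeps each \<open>r\<^sub>n\<close> independently with probability \<open>\<rho>(x\<^sub>n)\<close>: the expected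
  exponential sums of the selection are averages of \<open>\<rho>(x\<^sub>n) e(r\<^sub>n \<beta>)\<close>, which converge since \<open>\<rho>\<close> is
  a uniform limit of trigonometric polynomials (\<open>twisted_average\<close>), and the deviation of the first
  \<open>N\<close> terms from expectation is, uniformly in \<open>\<beta>\<close>, at most of order \<open>sqrt (N log r\<^sub>N)\<close>.  This is \<open>o(N)\<close>
  exactly because \<open>R\<close> is sublacunary.

  A general density is neither continuous nor bounded.  Take continuous \<open>\<rho>\<^sub>i \<ge> 0\<close> that converge to
  \<open>\<rho>\<close> geometrically in \<open>L\<^sup>1(\<mu>)\<close> (\<open>density_approximation\<close>) and select \<open>r\<^sub>n\<close> with probability
  \<open>p\<^sub>n = w\<^sub>n \<rho>\<^sub>k\<^sub>(\<^sub>n\<^sub>)(x\<^sub>n)\<close>, where \<open>k(n)\<close> tends to infinity so slowly, and the weights \<open>w\<^sub>n\<close> decrease so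
  slowly to 0, that the deviation is still negligible against \<open>W\<^sub>N = \<Sum>n<N. w\<^sub>n\<close>
  (\<open>slow_weights\<close>, \<open>selection_exists\<close>).  Two facts make this work for every \<open>\<beta>\<close> at once, although
  the averages for different \<open>\<beta>\<close> converge at different rates.  Decreasing
  weights with infinite sum preserve convergence of averages, whatever the rate
  (\<open>weighted_average_tendsto\<close>).  And replacing
  \<open>\<rho>\<^sub>k\<^sub>(\<^sub>n\<^sub>)\<close> by a fixed \<open>\<rho>\<^sub>j\<close> costs an amount that is controlled by the averages of
  \<open>\<bar>\<rho>\<^sub>i\<^sub>+\<^sub>1(x\<^sub>n) - \<rho>\<^sub>i(x\<^sub>n)\<bar>\<close> for \<open>i \<ge> j\<close>, hence does not involve \<open>\<beta>\<close> and vanishes as \<open>j\<close> grows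
  (\<open>diagonal_average\<close>).  The averages over the selected terms are the quotients of the selected sums
  by their number, and both are compared with \<open>W\<^sub>N\<close> (\<open>selected_average\<close>).

  The random choice is replaced by a deterministic one: the terms are decided one after the other so
  that an exponential-moment potential, summed over countably many tests, never exceeds its bound
  (\<open>derandomised_selection\<close>).
\<close>

section \<open>Derandomised selection\<close>

lemma exp_le_quadratic:
  fixes y :: real
  assumes "\<bar>y\<bar> \<le> 1"
  shows "exp y \<le> 1 + y + y\<^sup>2"
proof (cases "0 \<le> y")
  case True
  then show ?thesis using assms exp_bound[of y] by simp
next
  case False
  have "1 \<le> (1 - y + (-y)\<^sup>2 / 2) * (1 + y + y\<^sup>2)"
  proof -
    have "(1 - y + (-y)\<^sup>2 / 2) * (1 + y + y\<^sup>2) = 1 + y\<^sup>2 * (1 - y + y\<^sup>2) / 2"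
      by (simp add: field_simps power2_eq_square)
    then show ?thesis using False by (simp add: sum_nonneg)
  qed
  also have "\<dots> \<le> exp (-y) * (1 + y + y\<^sup>2)"
  proof (rule mult_right_mono)
    show "1 - y + (-y)\<^sup>2 / 2 \<le> exp (-y)"
      using exp_lower_Taylor_quadratic[of "-y"] False by simp
    show "0 \<le> 1 + y + y\<^sup>2" using assms by (smt (verit) zero_le_power2)
  qed
  finally show ?thesis by (simp add: exp_minus field_simps)
qed

text \<open>
  A crude form of Hoeffding's inequality: the exponential moment of a centred Bernoulli variable.
\<close>

lemma bernoulli_mgf_le:
  fixes p x :: real
  assumes "0 \<le> p" "p \<le> 1" "\<bar>x\<bar> \<le> 1"
  shows "p * exp ((1 - p) * x) + (1 - p) * exp ((0 - p) * x) \<le> exp (x\<^sup>2)"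
proof -
  have a: "\<bar>(1 - p) * x\<bar> \<le> 1" "\<bar>(0 - p) * x\<bar> \<le> 1"
    using assms by (auto simp: abs_mult intro!: mult_le_one)
  have "p * exp ((1 - p) * x) + (1 - p) * exp ((0 - p) * x)
      \<le> p * (1 + (1 - p) * x + ((1 - p) * x)\<^sup>2) + (1 - p) * (1 + (0 - p) * x + ((0 - p) * x)\<^sup>2)"
    using assms a by (intro add_mono mult_left_mono exp_le_quadratic) auto
  also have "\<dots> = 1 + p * (1 - p) * x\<^sup>2"
    by (simp add: field_simps power2_eq_square)
  also have "\<dots> \<le> 1 + x\<^sup>2"
    using assms mult_le_one[of p "1 - p"] mult_right_mono[of "p * (1 - p)" 1 "x\<^sup>2"] by simp
  also have "\<dots> \<le> exp (x\<^sup>2)" by (rule exp_ge_add_one_self)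
  finally show ?thesis .
qed

lemma summable_mult_exp:
  fixes om f :: "nat \<Rightarrow> real"
  assumes "\<And>i. 0 < om i" "summable om" "\<And>i. f i \<le> d"
  shows "summable (\<lambda>i. om i * exp (f i))"
proof (rule summable_comparison_test'[OF summable_mult2[OF assms(2), of "exp d"]])
  show "norm (om n * exp (f n)) \<le> om n * exp d" for n
    using assms(1)[of n] assms(3)[of n] by (simp add: abs_mult mult_left_mono)
qed

text \<open>
  Conditional expectations: if \<open>b\<close> is 1 with probability \<open>p\<close>, each summand of the potential has
  expectation at most its old value, because the exponent is lowered by \<open>(lam i)\<^sup>2\<close> in compensation
  for the moment bound.  So one of the two values of \<open>b\<close> does not increase the total.
\<close>

lemma potential_step:
  fixes om lam s u :: "nat \<Rightarrow> real" and p c :: real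
  assumes p: "0 \<le> p" "p \<le> 1" and u: "\<And>i. \<bar>u i\<bar> \<le> 1" and lam: "\<And>i. 0 < lam i" "\<And>i. lam i \<le> 1"
    and om: "\<And>i. 0 < om i" "summable om"
    and s: "\<And>i. s i \<le> c" and pot: "(\<Sum>i. om i * exp (s i)) \<le> 1"
  shows "\<exists>b\<in>{0,1}. (\<Sum>i. om i * exp (s i + lam i * ((b - p) * u i) - (lam i)\<^sup>2)) \<le> 1"
proof (rule ccontr)
  define t where "t b i = s i + lam i * ((b - p) * u i) - (lam i)\<^sup>2" for b i
  assume neg: "\<not> ?thesis"
  have lu: "\<bar>lam i * u i\<bar> \<le> 1" for i
    using u[of i] lam[of i] by (auto simp: abs_mult intro!: mult_le_one)
  have sum: "summable (\<lambda>i. om i * exp (f i))" if "\<And>i. f i \<le> d" for f and d :: real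
    using om that by (rule summable_mult_exp)
  have tb: "t b i \<le> c + 1" if "b \<in> {0,1}" for b i
  proof -
    have "\<bar>lam i * ((b - p) * u i)\<bar> = \<bar>b - p\<bar> * \<bar>lam i * u i\<bar>" by (simp add: abs_mult)
    also have "\<dots> \<le> 1" using that p lu[of i] by (intro mult_le_one) auto
    finally show ?thesis using s[of i] zero_le_power2[of "lam i"] unfolding t_def by linarith
  qed
  have S: "summable (\<lambda>i. om i * exp (t b i))" if "b \<in> {0,1}" for b
    using tb[OF that] by (rule sum)
  have "p * (\<Sum>i. om i * exp (t 1 i)) + (1 - p) * (\<Sum>i. om i * exp (t 0 i))
      = (\<Sum>i. p * (om i * exp (t 1 i)) + (1 - p) * (om i * exp (t 0 i)))"
    using S[of 0] S[of 1] by (simp add: suminf_mult summable_mult flip: suminf_add)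
  also have "\<dots> \<le> (\<Sum>i. om i * exp (s i))"
  proof (rule suminf_le)
    fix i
    have e: "exp (t b i) = exp (s i) * exp (- (lam i)\<^sup>2) * exp ((b - p) * (lam i * u i))" for b
      unfolding t_def by (simp add: algebra_simps flip: exp_add)
    have "p * (om i * exp (t 1 i)) + (1 - p) * (om i * exp (t 0 i))
        = om i * exp (s i) * exp (- (lam i)\<^sup>2) *
           (p * exp ((1 - p) * (lam i * u i)) + (1 - p) * exp ((0 - p) * (lam i * u i)))"
      unfolding e by (simp add: algebra_simps)
    also have "\<dots> \<le> om i * exp (s i) * exp (- (lam i)\<^sup>2) * exp ((lam i * u i)\<^sup>2)"
      using om(1)[of i] by (intro mult_left_mono bernoulli_mgf_le p lu) auto
    also have "\<dots> = om i * exp (s i) * exp ((lam i * u i)\<^sup>2 - (lam i)\<^sup>2)"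
      by (simp add: mult.assoc flip: exp_add)
    also have "\<dots> \<le> om i * exp (s i) * 1"
    proof (rule mult_left_mono)
      have "(u i)\<^sup>2 \<le> 1" using u[of i] by (simp add: abs_square_le_1)
      then have "(lam i)\<^sup>2 * (u i)\<^sup>2 \<le> (lam i)\<^sup>2 * 1" by (intro mult_left_mono) auto
      then show "exp ((lam i * u i)\<^sup>2 - (lam i)\<^sup>2) \<le> 1" by (simp add: power_mult_distrib)
    qed (use om(1)[of i] in auto)
    finally show "p * (om i * exp (t 1 i)) + (1 - p) * (om i * exp (t 0 i)) \<le> om i * exp (s i)" by simp
  qed (use S in \<open>auto intro!: summable_add summable_mult sum[OF s]\<close>)
  finally have "p * (\<Sum>i. om i * exp (t 1 i)) + (1 - p) * (\<Sum>i. om i * exp (t 0 i)) \<le> 1"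
    using pot by linarith
  moreover have g: "1 < (\<Sum>i. om i * exp (t 1 i))" "1 < (\<Sum>i. om i * exp (t 0 i))"
    using neg unfolding t_def by auto
  have "1 < p * (\<Sum>i. om i * exp (t 1 i)) + (1 - p) * (\<Sum>i. om i * exp (t 0 i))"
  proof (cases "p = 0")
    case False
    then have "p * 1 < p * (\<Sum>i. om i * exp (t 1 i))" using p g by (intro mult_strict_left_mono) auto
    moreover have "(1 - p) * 1 \<le> (1 - p) * (\<Sum>i. om i * exp (t 0 i))" using p g by (intro mult_left_mono) auto
    ultimately show ?thesis using add_less_le_mono by fastforce
  qed (use g in auto)
  ultimately show False by linarith
qed

text \<open>
  The test \<open>i\<close> has the potential \<open>om i\<close> times the exponential of \<open>lam i\<close> times its deviation minus
  \<open>(lam i)\<^sup>2 n\<close>.  The potentials have total 1 at the start and are never allowed to exceed it in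
  total; each of them is therefore at most 1 at every time, which is the asserted bound.  A test
  costs only the logarithm of its weight, so polynomially many tests are cheap.
\<close>

lemma derandomised_selection:
  fixes om lam p :: "nat \<Rightarrow> real" and u :: "nat \<Rightarrow> nat \<Rightarrow> real"
  assumes p: "\<And>n. 0 \<le> p n" "\<And>n. p n \<le> 1" and u: "\<And>i n. \<bar>u i n\<bar> \<le> 1"
    and lam: "\<And>i. 0 < lam i" "\<And>i. lam i \<le> 1"
    and om: "\<And>i. 0 < om i" "om sums 1"
  shows "\<exists>A. \<forall>i n. lam i * (\<Sum>m<n. (indicator A m - p m) * u i m) \<le> (lam i)\<^sup>2 * n - ln (om i)"
proof -
  have som: "summable om" and tom: "suminf om = 1" using om(2) by (auto simp: sums_iff)
  define step where "step n s b = (\<lambda>i. s i + lam i * ((b - p n) * u i n) - (lam i)\<^sup>2)" for n b and s :: "nat \<Rightarrow> real"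
  \<comment> \<open>The upper bound on the exponents guarantees that the potential is a convergent series.\<close>
  define Q where "Q n s \<longleftrightarrow> (\<exists>c. \<forall>i. s i \<le> c) \<and> (\<Sum>i. om i * exp (s i)) \<le> 1" for n :: nat and s :: "nat \<Rightarrow> real"
  have "\<exists>f. f 0 = (\<lambda>_. 0) \<and> (\<forall>n. Q n (f n) \<and> (\<exists>b\<in>{0,1}. f (Suc n) = step n (f n) b))"
  proof -
    have "\<exists>f. \<forall>n. (Q n (f n) \<and> (n = 0 \<longrightarrow> f n = (\<lambda>_. 0))) \<and> (\<exists>b\<in>{0,1}. f (Suc n) = step n (f n) b)"
    proof (rule dependent_nat_choice)
      show "\<exists>x. Q 0 x \<and> (0 = 0 \<longrightarrow> x = (\<lambda>_. 0))"
        unfolding Q_def using tom by auto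
      fix s n assume "Q n s \<and> (n = 0 \<longrightarrow> s = (\<lambda>_. 0))"
      then obtain c where c: "\<And>i. s i \<le> c" and s: "(\<Sum>i. om i * exp (s i)) \<le> 1" unfolding Q_def by blast
      obtain b where b: "b \<in> {0,1}" "(\<Sum>i. om i * exp (step n s b i)) \<le> 1"
        using potential_step[where s = s and c = c and p = "p n" and u = "\<lambda>i. u i n" and om = om and lam = lam]
          p u lam om som c s unfolding step_def by blast
      have "step n s b i \<le> c + 1" for i
      proof -
        have "\<bar>lam i * ((b - p n) * u i n)\<bar> = lam i * (\<bar>b - p n\<bar> * \<bar>u i n\<bar>)"
          using lam(1)[of i] by (simp add: abs_mult)
        also have "\<dots> \<le> 1" using b p[of n] u[of i n] lam[of i] by (intro mult_le_one mult_nonneg_nonneg) auto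
        finally show ?thesis using c[of i] zero_le_power2[of "lam i"] unfolding step_def by linarith
      qed
      then show "\<exists>y. (Q (Suc n) y \<and> (Suc n = 0 \<longrightarrow> y = (\<lambda>_. 0))) \<and> (\<exists>b\<in>{0,1}. y = step n s b)"
        using b unfolding Q_def by blast
    qed
    then show ?thesis by blast
  qed
  then obtain f where f0: "f 0 = (\<lambda>_. 0)" and fQ: "\<And>n. Q n (f n)"
    and fS: "\<And>n. \<exists>b\<in>{0,1}. f (Suc n) = step n (f n) b" by blast
  obtain b where b: "\<And>n. b n \<in> {0,1}" "\<And>n. f (Suc n) = step n (f n) (b n)" using fS by metis
  define A where "A = {n. b n = 1}"
  have bA: "b n = indicator A n" for n using b(1)[of n] by (auto simp: A_def)
  have f: "f n i = lam i * (\<Sum>m<n. (indicator A m - p m) * u i m) - (lam i)\<^sup>2 * n" for n i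
    by (induction n) (auto simp: f0 b(2) step_def bA algebra_simps)
  have "lam i * (\<Sum>m<n. (indicator A m - p m) * u i m) \<le> (lam i)\<^sup>2 * n - ln (om i)" for i n
  proof -
    obtain c where c: "\<And>i. f n i \<le> c" and s: "(\<Sum>i. om i * exp (f n i)) \<le> 1"
      using fQ[of n] unfolding Q_def by blast
    have sm: "summable (\<lambda>i. om i * exp (f n i))"
      using om(1) som c by (rule summable_mult_exp)
    have "om i * exp (f n i) \<le> 1"
      using sum_le_suminf[OF sm, of "{i}"] om(1) s by (simp add: less_imp_le)
    then have "ln (om i * exp (f n i)) \<le> 0" using om(1)[of i] by (subst ln_le_zero_iff) auto
    then have "ln (om i) + f n i \<le> 0" using om(1)[of i] by (simp add: ln_mult)
    then show ?thesis unfolding f by simp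
  qed
  then show ?thesis by blast
qed

section \<open>Discrepancy against all characters\<close>

lemma echar_add: "echar (x + y) = echar x * echar y"
  by (simp add: echar_cis distrib_left flip: cis_mult)

lemma norm_echar [simp]: "cmod (echar x) = 1"
  by (simp add: echar_cis)

lemma echar_lipschitz: "cmod (echar x - echar y) \<le> 2 * pi * \<bar>x - y\<bar>"
proof -
  have "echar x = echar y * echar (x - y)" by (simp flip: echar_add)
  then have "cmod (echar x - echar y) = cmod (echar y * (echar (x - y) - 1))"
    by (simp add: algebra_simps)
  also have "\<dots> = cmod (exp (\<i> * of_real (2 * pi * (x - y))) - 1)"
    by (simp add: norm_mult echar_def mult_ac)
  also have "\<dots> \<le> \<bar>2 * pi * (x - y)\<bar>"
    using iexp_approx1[of "2 * pi * (x - y)" 0] by simp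
  finally show ?thesis by (simp add: abs_mult)
qed

lemma echar_frac: "echar (real k * x) = echar (real k * frac x)"
proof -
  have "real k * x - real k * frac x = of_int (int k * \<lfloor>x\<rfloor>)"
    by (simp add: frac_def algebra_simps)
  then show ?thesis unfolding echar_eq_iff by (metis Ints_of_int)
qed

lemma echar_quarters:
  "echar 0 = 1" "echar (1 / 4) = \<i>" "echar (1 / 2) = -1" "echar (3 / 4) = - \<i>"
proof -
  show "echar 0 = 1" by (simp add: echar_cis)
  show 1: "echar (1 / 4) = \<i>" by (simp add: echar_cis complex_eq_iff)
  show 2: "echar (1 / 2) = -1" by (simp add: echar_cis)
  have "echar (3 / 4) = echar (1 / 2) * echar (1 / 4)" by (simp flip: echar_add)
  then show "echar (3 / 4) = - \<i>" unfolding 1 2 by simp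
qed

text \<open>
  These weights serve as \<open>om\<close>: the logarithm of the weight of a test is then only logarithmic in
  the number of the test.
\<close>

lemma telescoping_weights: "(\<lambda>i. 1 / ((real i + 1) * (real i + 2))) sums 1"
proof -
  have "(\<Sum>i<n. 1 / ((real i + 1) * (real i + 2))) = 1 - 1 / (real n + 1)" for n
  proof (induction n)
    case (Suc n)
    have "1 / ((real n + 1) * (real n + 2)) = 1 / (real n + 1) - 1 / (real (Suc n) + 1)"
      by (simp add: divide_simps)
    then show ?case using Suc by simp
  qed simp
  moreover have "(\<lambda>n. 1 - 1 / (real n + 1)) \<longlonglongrightarrow> 1 - 0"
    using LIMSEQ_inverse_real_of_nat by (intro tendsto_intros) (simp add: inverse_eq_divide add.commute)
  ultimately show ?thesis unfolding sums_def by simp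
qed

lemma prod_encode_le: "prod_encode (a, b) \<le> (a + b + 1)\<^sup>2"
proof -
  have "2 * triangle (a + b) = (a + b) * (a + b + 1)" by (simp add: triangle_def)
  then have "2 * prod_encode (a, b) \<le> 2 * (a + b + 1)\<^sup>2"
    by (simp add: prod_encode_def power2_eq_square algebra_simps)
  then show ?thesis by simp
qed

text \<open>
  The tests that concern the first \<open>N\<close> terms are labelled by a frequency \<open>j / r\<^sup>2\<close> and a quarter
  turn \<open>s\<close>.  Their numbers are polynomial in \<open>r\<close>, where \<open>r\<close> stands for \<open>r\<^sub>N\<close>.
\<close>

lemma test_index_bound:
  assumes "N \<le> r" "1 \<le> r" "j < r\<^sup>2" "s < 4"
  shows "prod_encode (N, prod_encode (j, s)) \<le> 324 * r ^ 8"
proof -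
  have r1: "1 \<le> r\<^sup>2" "1 \<le> r ^ 4" "r \<le> r ^ 4"
    using assms(2) self_le_power[of r 4] by auto
  have "prod_encode (j, s) \<le> (j + s + 1)\<^sup>2" by (rule prod_encode_le)
  also have "\<dots> \<le> (4 * r\<^sup>2)\<^sup>2" using assms r1 by (intro power_mono) auto
  finally have i: "prod_encode (j, s) \<le> 16 * r ^ 4" by (simp add: power_mult_distrib flip: power_mult)
  have "prod_encode (N, prod_encode (j, s)) \<le> (N + prod_encode (j, s) + 1)\<^sup>2" by (rule prod_encode_le)
  also have "\<dots> \<le> (18 * r ^ 4)\<^sup>2" using assms r1 i by (intro power_mono) auto
  also have "\<dots> = 324 * r ^ 8" by (simp add: power_mult_distrib flip: power_mult)
  finally show ?thesis .
qed

lemma test_weight_bound: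
  assumes "i \<le> 324 * r ^ 8" "1 \<le> (r::nat)"
  shows "- ln (1 / ((real i + 1) * (real i + 2))) \<le> 16 * ln (real r) + 20"
proof -
  have "1 \<le> r ^ 8" using assms(2) by simp
  then have "i + 2 \<le> 512 * r ^ 8" using assms by linarith
  then have "real (i + 2) \<le> real (512 * r ^ 8)" by (simp only: of_nat_le_iff)
  then have i: "real i + 2 \<le> 2 ^ 9 * real r ^ 8" by simp
  have "ln (real i + 2) \<le> ln (2 ^ 9 * real r ^ 8)" using i assms(2) by (subst ln_le_cancel_iff) auto
  also have "\<dots> = 9 * ln 2 + 8 * ln (real r)" using assms(2) ln_realpow[of "2::real" 9]
    by (simp add: ln_mult ln_realpow)
  also have "\<dots> \<le> 10 + 8 * ln (real r)" using ln_2_less_1 by simp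
  finally have l: "ln (real i + 2) \<le> 10 + 8 * ln (real r)" .
  have "- ln (1 / ((real i + 1) * (real i + 2))) = ln (real i + 1) + ln (real i + 2)"
    by (simp add: ln_div ln_mult)
  also have "\<dots> \<le> 2 * ln (real i + 2)" by simp
  finally show ?thesis using l by simp
qed

text \<open>
  For given \<open>N\<close> it suffices to test the frequencies in the grid of mesh \<open>1 / (r N)\<^sup>2\<close>: moving
  \<open>\<beta>\<close> to the grid changes each term by at most \<open>2 pi / r N\<close>, hence the sum by at most
  \<open>2 pi\<close>.  The four quarter turns bound the real and the imaginary part from both sides.
\<close>

lemma uniform_selection:
  fixes r :: "nat \<Rightarrow> nat" and p lam :: "nat \<Rightarrow> real"
  assumes r: "mono r" "\<And>n. n \<le> r n" "\<And>n. 1 \<le> r n"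
    and p: "\<And>n. 0 \<le> p n" "\<And>n. p n \<le> 1" and lam: "\<And>n. 0 < lam n" "\<And>n. lam n \<le> 1"
  shows "\<exists>A. \<forall>N \<beta>. cmod (\<Sum>m<N. of_real (indicator A m - p m) * echar (real (r m) * \<beta>))
      \<le> 2 * (lam N * N + (16 * ln (real (r N)) + 20) / lam N) + 2 * pi"
proof -
  define u where "u i m = (case prod_decode i of (N, k) \<Rightarrow> case prod_decode k of (j, s) \<Rightarrow>
      Re (echar (real (r m) * (real j / (real (r N))\<^sup>2) + real s / 4)))" for i m
  define om where "om i = 1 / ((real i + 1) * (real i + 2))" for i :: nat
  have "\<bar>u i m\<bar> \<le> 1" for i m
    unfolding u_def by (auto split: prod.split intro: order_trans[OF abs_Re_le_cmod])
  then have "\<exists>A. \<forall>i n. lam (fst (prod_decode i)) * (\<Sum>m<n. (indicator A m - p m) * u i m)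
        \<le> (lam (fst (prod_decode i)))\<^sup>2 * n - ln (om i)"
    using telescoping_weights p lam
    by (intro derandomised_selection[where om = om]) (auto simp: om_def[abs_def])
  then obtain A where A: "\<And>i n. lam (fst (prod_decode i)) * (\<Sum>m<n. (indicator A m - p m) * u i m)
        \<le> (lam (fst (prod_decode i)))\<^sup>2 * n - ln (om i)" by blast
  have "cmod (\<Sum>m<N. of_real (indicator A m - p m) * echar (real (r m) * \<beta>))
      \<le> 2 * (lam N * N + (16 * ln (real (r N)) + 20) / lam N) + 2 * pi" for N \<beta>
  proof -
    define G where "G = (r N)\<^sup>2"
    define j where "j = nat \<lfloor>frac \<beta> * G\<rfloor>"
    define B where "B = lam N * N + (16 * ln (real (r N)) + 20) / lam N"
    define Z where "Z = (\<Sum>m<N. of_real (indicator A m - p m) * echar (real (r m) * (j / G)))"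
    have G: "G > 0" using r(3)[of N] by (simp add: G_def)
    have j1: "real j \<le> frac \<beta> * G" "frac \<beta> * G < real j + 1"
      unfolding j_def using frac_ge_0[of \<beta>] by (simp_all add: of_nat_nat)
    have "frac \<beta> * G < 1 * real G" using frac_lt_1[of \<beta>] G by (intro mult_strict_right_mono) auto
    then have jG: "j < G" using j1 by linarith
    have test: "Re (echar (real s / 4) * Z) \<le> B" if "s < 4" for s
    proof -
      define i where "i = prod_encode (N, prod_encode (j, s))"
      have "i \<le> 324 * r N ^ 8"
        unfolding i_def using test_index_bound r jG that by (auto simp: G_def)
      then have om: "- ln (om i) \<le> 16 * ln (real (r N)) + 20"
        unfolding om_def using r(3) by (rule test_weight_bound)
      have "Re (echar (real s / 4) * Z) = (\<Sum>m<N. (indicator A m - p m) * u i m)"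
        unfolding Z_def sum_distrib_left Re_sum
        by (intro sum.cong) (auto simp: u_def i_def G_def echar_add algebra_simps)
      then have "lam N * Re (echar (real s / 4) * Z) \<le> (lam N)\<^sup>2 * N - ln (om i)"
        using A[of i N] by (simp add: i_def)
      also have "\<dots> \<le> (lam N)\<^sup>2 * N + (16 * ln (real (r N)) + 20)"
        using om by simp
      also have "\<dots> = lam N * B"
        using lam(1)[of N] by (simp add: B_def power2_eq_square field_simps)
      finally show ?thesis using lam(1)[of N] by simp
    qed
    have "\<bar>Re Z\<bar> \<le> B" "\<bar>Im Z\<bar> \<le> B"
      using test[of 0] test[of 1] test[of 2] test[of 3] by (auto simp: echar_quarters)
    then have Z: "cmod Z \<le> 2 * B" using cmod_le[of Z] by linarith
    have "cmod ((\<Sum>m<N. of_real (indicator A m - p m) * echar (real (r m) * \<beta>)) - Z)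
        = cmod (\<Sum>m<N. of_real (indicator A m - p m) * (echar (real (r m) * frac \<beta>) - echar (real (r m) * (j / G))))"
      unfolding Z_def by (simp add: sum_subtractf right_diff_distrib flip: echar_frac)
    also have "\<dots> \<le> (\<Sum>m<N. 2 * pi / r N)"
    proof (rule sum_norm_le)
      fix m assume "m \<in> {..<N}"
      then have rm: "r m \<le> r N" using r(1) by (simp add: monoD)
      have a: "\<bar>indicator A m - p m\<bar> \<le> 1" using p[of m] by (auto simp: indicator_def)
      have "frac \<beta> - j / G = (frac \<beta> * G - j) / G" using G by (simp add: diff_divide_distrib)
      then have d: "\<bar>frac \<beta> - j / G\<bar> \<le> 1 / G" using j1 G by (simp add: divide_right_mono)
      have "cmod (of_real (indicator A m - p m) * (echar (real (r m) * frac \<beta>) - echar (real (r m) * (j / G))))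
          \<le> 1 * (2 * pi * \<bar>real (r m) * frac \<beta> - real (r m) * (j / G)\<bar>)"
        unfolding norm_mult norm_of_real using a by (intro mult_mono echar_lipschitz) auto
      also have "\<dots> = 2 * pi * (real (r m) * \<bar>frac \<beta> - j / G\<bar>)"
        using abs_mult[of "real (r m)" "frac \<beta> - j / G"] by (simp add: right_diff_distrib)
      also have "\<dots> \<le> 2 * pi * (real (r N) * (1 / G))"
        using rm d by (intro mult_left_mono mult_mono) auto
      also have "\<dots> = 2 * pi / r N" by (simp add: G_def power2_eq_square)
      finally show "cmod (of_real (indicator A m - p m) * (echar (real (r m) * frac \<beta>) - echar (real (r m) * (j / G))))
          \<le> 2 * pi / r N" .
    qed
    also have "\<dots> = 2 * pi * (N / r N)" by simp
    also have "\<dots> \<le> 2 * pi * 1"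
      using r(2)[of N] r(3)[of N] by (intro mult_left_mono) (auto simp: divide_simps)
    finally show ?thesis
      using Z norm_triangle_sub[of "\<Sum>m<N. of_real (indicator A m - p m) * echar (real (r m) * \<beta>)" Z]
      unfolding B_def by linarith
  qed
  then show ?thesis by blast
qed

text \<open>
  Sublacunarity is the growth condition evaluated at the elements of \<open>R\<close> themselves.
\<close>

lemma sublacunary_log_growth:
  assumes R: "infinite R" "0 \<notin> R" "sublacunary R"
  shows "(\<lambda>n. ln (real (enumerate R n)) / n) \<longlonglongrightarrow> 0"
proof -
  define r where "r = enumerate R"
  have sm: "strict_mono r" unfolding r_def using R(1) by (rule strict_mono_enumerate)
  have range: "range r = R" unfolding r_def using R(1) by (rule range_enumerate)
  have pos: "1 \<le> r n" for n using R(2) range by (metis One_nat_def Suc_leI gr0I rangeI)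
  have card: "card (R \<inter> {1..r n}) = Suc n" for n
  proof -
    have "R \<inter> {1..r n} = r ` {..n}"
      using range pos sm by (auto simp: strict_mono_less_eq)
    then show ?thesis using sm by (simp add: card_image strict_mono_on_imp_inj_on strict_mono_imp_inj_on inj_on_subset)
  qed
  have "filterlim r at_top sequentially" using sm by (rule filterlim_subseq)
  then have "filterlim (\<lambda>n. real (Suc n) / ln (real (r n))) at_top sequentially"
    using filterlim_compose[OF R(3)[unfolded sublacunary_def]] card by fastforce
  then have "(\<lambda>n. inverse (real (Suc n) / ln (real (r n)))) \<longlonglongrightarrow> 0"
    by (rule tendsto_inverse_0_at_top)
  then have *: "(\<lambda>n. ln (real (r n)) / Suc n) \<longlonglongrightarrow> 0" by simp
  have "(\<lambda>n. ln (real (r n)) / Suc n * (real (Suc n) / real n)) \<longlonglongrightarrow> 0 * 1"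
    by (intro tendsto_mult * LIMSEQ_Suc_n_over_n)
  then show ?thesis unfolding r_def by (simp add: mult.commute)
qed

section \<open>Averages with decreasing weights\<close>

text \<open>
  Abel summation in a form that goes through by induction: as the bracket is nonpositive, passing to
  the smaller weight \<open>w (Suc N)\<close> only increases the first summand.
\<close>

lemma abel_sum_bounded:
  fixes w c :: "nat \<Rightarrow> real"
  assumes w: "antimono w" and C: "\<And>n. (\<Sum>m<n. c m) \<le> K"
  shows "(\<Sum>n<N. w n * c n) \<le> w N * ((\<Sum>n<N. c n) - K) + K * w 0"
proof (induction N)
  case (Suc N)
  have "w N * ((\<Sum>n<Suc N. c n) - K) \<le> w (Suc N) * ((\<Sum>n<Suc N. c n) - K)"
    using w C[of "Suc N"] by (intro mult_right_mono_neg) (auto simp: antimono_def)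
  with Suc show ?case by (simp add: algebra_simps)
qed simp

lemma weighted_sum_le:
  fixes w a :: "nat \<Rightarrow> real"
  assumes w: "antimono w" "\<And>n. 0 \<le> w n" and A: "\<And>n. (\<Sum>m<n. a m) \<le> E * n + K"
  shows "(\<Sum>n<N. w n * a n) \<le> E * (\<Sum>n<N. w n) + K * w 0"
proof -
  have C: "(\<Sum>m<n. a m - E) \<le> K" for n using A[of n] by (simp add: sum_subtractf mult.commute)
  have "(\<Sum>n<N. w n * (a n - E)) \<le> w N * ((\<Sum>n<N. a n - E) - K) + K * w 0"
    using abel_sum_bounded[OF w(1) C] .
  also have "\<dots> \<le> K * w 0" using C[of N] w(2)[of N] by (simp add: mult_nonneg_nonpos)
  finally show ?thesis by (simp add: right_diff_distrib sum_subtractf sum_distrib_left mult.commute)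
qed

text \<open>
  For large \<open>N\<close> the partial sums of \<open>a\<close> lie below \<open>(L + e / 2) N\<close>; a constant \<open>K\<close> absorbs the
  finitely many exceptions, and divergence of the weights makes \<open>K\<close> negligible.
\<close>

lemma weighted_average_upper:
  fixes w a :: "nat \<Rightarrow> real"
  assumes w: "antimono w" "\<And>n. 0 < w n" and W: "filterlim (\<lambda>N. \<Sum>n<N. w n) at_top sequentially"
    and L: "(\<lambda>N. (\<Sum>n<N. a n) / N) \<longlonglongrightarrow> L" and "e > 0"
  shows "eventually (\<lambda>N. (\<Sum>n<N. w n * a n) / (\<Sum>n<N. w n) \<le> L + e) sequentially"
proof -
  have "eventually (\<lambda>N. (\<Sum>n<N. a n) / N < L + e / 2) sequentially"
    using order_tendstoD(2)[OF L, of "L + e/2"] \<open>e > 0\<close> by auto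
  then obtain N0 where N0: "\<And>N. N \<ge> N0 \<Longrightarrow> (\<Sum>n<N. a n) / N < L + e / 2"
    unfolding eventually_sequentially by blast
  define K where "K = (\<Sum>n\<le>N0. \<bar>(\<Sum>m<n. a m) - (L + e / 2) * n\<bar>)"
  have K: "0 \<le> K" unfolding K_def by (intro sum_nonneg) auto
  have A: "(\<Sum>m<n. a m) \<le> (L + e / 2) * n + K" for n
  proof (cases "n > N0")
    case True
    then show ?thesis using N0[of n] K by (simp add: field_simps)
  next
    case False
    then have "\<bar>(\<Sum>m<n. a m) - (L + e / 2) * n\<bar> \<le> K"
      unfolding K_def by (intro member_le_sum[where f = "\<lambda>n. \<bar>(\<Sum>m<n. a m) - (L + e / 2) * real n\<bar>"]) auto
    then show ?thesis by linarith
  qed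
  have le: "(\<Sum>n<N. w n * a n) \<le> (L + e / 2) * (\<Sum>n<N. w n) + K * w 0" for N
    using w A by (intro weighted_sum_le) (auto simp: less_imp_le)
  have "eventually (\<lambda>N. (\<Sum>n<N. w n) \<ge> max 1 (2 * K * w 0 / e)) sequentially"
    using W unfolding filterlim_at_top by blast
  then show ?thesis
  proof eventually_elim
    case (elim N)
    then have "(\<Sum>n<N. w n) > 0" "K * w 0 \<le> e / 2 * (\<Sum>n<N. w n)" using \<open>e > 0\<close> by (auto simp: field_simps)
    then show ?case using le[of N] by (simp add: field_simps)
  qed
qed

lemma weighted_average_tendsto_real:
  fixes w a :: "nat \<Rightarrow> real"
  assumes w: "antimono w" "\<And>n. 0 < w n" and W: "filterlim (\<lambda>N. \<Sum>n<N. w n) at_top sequentially"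
    and L: "(\<lambda>N. (\<Sum>n<N. a n) / N) \<longlonglongrightarrow> L"
  shows "(\<lambda>N. (\<Sum>n<N. w n * a n) / (\<Sum>n<N. w n)) \<longlonglongrightarrow> L"
proof (rule tendstoI)
  fix e :: real assume "e > 0"
  have L': "(\<lambda>N. (\<Sum>n<N. - a n) / N) \<longlonglongrightarrow> - L"
    using tendsto_minus[OF L] by (simp add: sum_negf)
  from weighted_average_upper[OF w W L, of "e/2"] weighted_average_upper[OF w W L', of "e/2"] \<open>e > 0\<close>
  have "eventually (\<lambda>N. (\<Sum>n<N. w n * a n) / (\<Sum>n<N. w n) \<le> L + e / 2) sequentially"
    "eventually (\<lambda>N. (\<Sum>n<N. w n * - a n) / (\<Sum>n<N. w n) \<le> - L + e / 2) sequentially" by auto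
  then show "eventually (\<lambda>N. dist ((\<Sum>n<N. w n * a n) / (\<Sum>n<N. w n)) L < e) sequentially"
  proof eventually_elim
    case (elim N)
    then show ?case using \<open>e > 0\<close> by (auto simp: dist_real_def sum_negf abs_less_iff)
  qed
qed

lemma weighted_average_tendsto:
  fixes w :: "nat \<Rightarrow> real" and a :: "nat \<Rightarrow> complex"
  assumes w: "antimono w" "\<And>n. 0 < w n" and W: "filterlim (\<lambda>N. \<Sum>n<N. w n) at_top sequentially"
    and L: "(\<lambda>N. (\<Sum>n<N. a n) / of_nat N) \<longlonglongrightarrow> L"
  shows "(\<lambda>N. (\<Sum>n<N. of_real (w n) * a n) / of_real (\<Sum>n<N. w n)) \<longlonglongrightarrow> L"
proof -
  have "(\<lambda>N. (\<Sum>n<N. Re (a n)) / N) \<longlonglongrightarrow> Re L" "(\<lambda>N. (\<Sum>n<N. Im (a n)) / N) \<longlonglongrightarrow> Im L"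
    using tendsto_Re[OF L] tendsto_Im[OF L] by simp_all
  from this[THEN weighted_average_tendsto_real[OF w W]]
  show ?thesis unfolding tendsto_complex_iff by (simp flip: of_real_sum)
qed

text \<open>
  The interchange of limits on which all approximation arguments below rest.  The error bound need
  only hold eventually, at a rate depending on \<open>j\<close>.
\<close>

lemma convergent_approx:
  fixes u :: "nat \<Rightarrow> 'a::banach"
  assumes v: "\<And>j. v j \<longlonglongrightarrow> L j" and E: "E \<longlonglongrightarrow> (0::real)"
    and uv: "\<And>j. eventually (\<lambda>N. norm (u N - v j N) \<le> E j) sequentially"
  shows "\<exists>l. u \<longlonglongrightarrow> l \<and> L \<longlonglongrightarrow> l"
proof -
  have "Cauchy u"
  proof (rule metric_CauchyI)
    fix e :: real assume "e > 0"
    then have "eventually (\<lambda>j. E j < e / 4) sequentially" using order_tendstoD(2)[OF E, of "e/4"] by auto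
    then obtain j where j: "E j < e / 4" by (auto simp: eventually_sequentially)
    have "eventually (\<lambda>N. norm (u N - v j N) \<le> E j \<and> dist (v j N) (L j) < e / 4) sequentially"
      using uv[of j] tendstoD[OF v[of j], of "e/4"] \<open>e > 0\<close> by (auto intro: eventually_conj)
    then obtain M where M: "\<And>N. N \<ge> M \<Longrightarrow> norm (u N - v j N) \<le> E j \<and> dist (v j N) (L j) < e / 4"
      unfolding eventually_sequentially by blast
    have d: "dist (u N) (L j) < e / 2" if "N \<ge> M" for N
      using M[OF that] j dist_triangle[of "u N" "L j" "v j N"] by (simp add: dist_norm)
    show "\<exists>M. \<forall>m\<ge>M. \<forall>n\<ge>M. dist (u m) (u n) < e"
      using d by (intro exI[of _ M]) (metis dist_commute dist_triangle_half_r)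
  qed
  then obtain l where l: "u \<longlonglongrightarrow> l" using Cauchy_convergent convergent_def by blast
  have "norm (l - L j) \<le> E j" for j
    by (rule tendsto_upperbound[OF tendsto_norm[OF tendsto_diff[OF l v[of j]]] uv[of j]]) simp
  then have "(\<lambda>j. L j - l) \<longlonglongrightarrow> 0"
    by (intro Lim_null_comparison[OF _ E]) (auto simp: norm_minus_commute)
  with l show ?thesis by (auto simp: LIM_zero_iff)
qed

section \<open>Continuous functions on the circle\<close>

lemma range_circ: "range circ = sphere 0 1"
proof
  show "range circ \<subseteq> sphere 0 1"
  proof
    fix z assume "z \<in> range circ"
    then obtain a where "z = circ a" by blast
    moreover obtain x where "a = to_circle x" by (rule to_circle_surj)
    ultimately show "z \<in> sphere 0 1" by (simp add: circ_to_circle echar_cis)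
  qed
  show "sphere 0 1 \<subseteq> range circ"
  proof
    fix z :: complex assume "z \<in> sphere 0 1"
    then have "z = cis (Arg z)"
      using cis_Arg[of z] by (cases "z = 0") (simp_all add: sgn_div_norm)
    then have "z = circ (to_circle (Arg z / (2 * pi)))"
      by (simp add: circ_to_circle echar_cis)
    then show "z \<in> range circ" by blast
  qed
qed

lemma trig_approximation:
  fixes f :: "circle \<Rightarrow> real"
  assumes f: "continuous_on UNIV f" and e: "0 < e"
  obtains g where "trig g" "\<And>x. cmod (of_real (f x) - g (circ x)) < e"
proof -
  define h where "h = f \<circ> inv circ"
  have "continuous_on (range circ) (inv circ)"
    by (rule continuous_on_inv[OF continuous_circ compact_circle]) (simp add: inj_circ)
  then have h: "continuous_on (sphere 0 1) h"
    unfolding h_def range_circ using f by (metis continuous_on_compose continuous_on_subset top_greatest)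
  have fh: "f x = h (circ x)" for x
    by (simp add: h_def inj_circ)
  obtain g where g: "trig1 g" "\<And>z. z \<in> sphere 0 1 \<Longrightarrow> \<bar>h z - g z\<bar> < e"
    using trig1_approx[OF h e] by auto
  obtain g' where g': "trig g'" "\<And>z. cmod z = 1 \<Longrightarrow> of_real (g z) = g' z"
    using g(1) unfolding trig1_def by blast
  show thesis
  proof (rule that[OF g'(1)])
    fix x
    have "circ x \<in> sphere 0 1" using range_circ by blast
    moreover from this have "g' (circ x) = of_real (g (circ x))" using g'(2) by simp
    ultimately show "cmod (of_real (f x) - g' (circ x)) < e"
      using g(2)[of "circ x"] fh by (simp flip: of_real_diff)
  qed
qed

text \<open>
  The type of the circle carries a topology but no metric, so density of the continuous functions in
  \<open>L\<^sup>1\<close> is proved directly: indicators of closed sets are limits of tent functions of the distance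
  after embedding the circle into the plane, and a Dynkin argument followed by approximation with
  simple functions does the rest.
\<close>

context
  fixes M :: "circle measure"
  assumes M: "finite_measure M" "sets M = sets borel"
begin

interpretation finite_measure M by (rule M)

lemma measurable_continuous:
  fixes g :: "circle \<Rightarrow> real"
  assumes "continuous_on UNIV g"
  shows "g \<in> borel_measurable M"
  unfolding measurable_cong_sets[OF M(2) refl] using assms by (rule borel_measurable_continuous_onI)

lemma integrable_continuous:
  fixes g :: "circle \<Rightarrow> real"
  assumes "continuous_on UNIV g"
  shows "integrable M g"
proof -
  obtain B where "\<And>x. \<bar>g x\<bar> \<le> B" using bounded_continuous_circle[OF assms] by blast
  then show ?thesis by (intro integrable_const_bound[of _ B] measurable_continuous[OF assms]) auto
qed

definition L1_approx :: "(circle \<Rightarrow> real) \<Rightarrow> bool"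
  where "L1_approx f \<longleftrightarrow> integrable M f \<and>
    (\<forall>e>0. \<exists>g. continuous_on UNIV g \<and> (\<integral>x. \<bar>f x - g x\<bar> \<partial>M) < e)"

lemma L1_approx_limit:
  assumes s: "\<And>n. L1_approx (s n)" and f: "integrable M f"
    and lim: "(\<lambda>n. \<integral>x. \<bar>f x - s n x\<bar> \<partial>M) \<longlonglongrightarrow> 0"
  shows "L1_approx f"
  unfolding L1_approx_def
proof (intro conjI allI impI)
  fix e :: real assume "e > 0"
  then have "eventually (\<lambda>n. (\<integral>x. \<bar>f x - s n x\<bar> \<partial>M) < e / 2) sequentially"
    using order_tendstoD(2)[OF lim, of "e/2"] by auto
  then obtain n where n: "(\<integral>x. \<bar>f x - s n x\<bar> \<partial>M) < e / 2" by (auto simp: eventually_sequentially)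
  obtain g where g: "continuous_on UNIV g" "(\<integral>x. \<bar>s n x - g x\<bar> \<partial>M) < e / 2"
    using s[of n] \<open>e > 0\<close> unfolding L1_approx_def by (meson half_gt_zero)
  have sn: "integrable M (s n)" using s[of n] unfolding L1_approx_def by blast
  note ig = integrable_continuous[OF g(1)]
  have "(\<integral>x. \<bar>f x - g x\<bar> \<partial>M) \<le> (\<integral>x. \<bar>f x - s n x\<bar> + \<bar>s n x - g x\<bar> \<partial>M)"
    using f sn ig by (intro integral_mono) auto
  also have "\<dots> = (\<integral>x. \<bar>f x - s n x\<bar> \<partial>M) + (\<integral>x. \<bar>s n x - g x\<bar> \<partial>M)"
    using f sn ig by (intro Bochner_Integration.integral_add) auto
  finally show "\<exists>g. continuous_on UNIV g \<and> (\<integral>x. \<bar>f x - g x\<bar> \<partial>M) < e"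
    using g n by (intro exI[of _ g]) auto
qed (rule f)

lemma L1_approx_dominated:
  assumes s: "\<And>n. L1_approx (s n)" and f: "integrable M f" and b: "integrable M b"
    and lim: "\<And>x. (\<lambda>n. s n x) \<longlonglongrightarrow> f x" and dom: "\<And>n x. \<bar>s n x\<bar> \<le> b x"
  shows "L1_approx f"
proof (rule L1_approx_limit[OF s f])
  have sn: "integrable M (s n)" for n using s[of n] unfolding L1_approx_def by blast
  have "(\<lambda>n. \<integral>x. \<bar>f x - s n x\<bar> \<partial>M) \<longlonglongrightarrow> (\<integral>x. 0 \<partial>M)"
  proof (rule integral_dominated_convergence[where w = "\<lambda>x. \<bar>f x\<bar> + b x"])
    show "AE x in M. (\<lambda>n. \<bar>f x - s n x\<bar>) \<longlonglongrightarrow> 0"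
    proof (rule AE_I2)
      fix x
      show "(\<lambda>n. \<bar>f x - s n x\<bar>) \<longlonglongrightarrow> 0"
        using tendsto_rabs[OF tendsto_diff[OF tendsto_const[of "f x"] lim[of x]]] by simp
    qed
    show "AE x in M. norm \<bar>f x - s n x\<bar> \<le> \<bar>f x\<bar> + b x" for n
    proof (rule AE_I2)
      fix x show "norm \<bar>f x - s n x\<bar> \<le> \<bar>f x\<bar> + b x" using dom[of n x] by simp
    qed
  qed (use f b sn in auto)
  then show "(\<lambda>n. \<integral>x. \<bar>f x - s n x\<bar> \<partial>M) \<longlonglongrightarrow> 0" by simp
qed

lemma L1_approx_add:
  assumes "L1_approx f" "L1_approx h"
  shows "L1_approx (\<lambda>x. f x + h x)"
  unfolding L1_approx_def
proof (intro conjI allI impI)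
  have i: "integrable M f" "integrable M h" using assms unfolding L1_approx_def by auto
  then show "integrable M (\<lambda>x. f x + h x)" by auto
  fix e :: real assume "e > 0"
  then obtain g g' where g: "continuous_on UNIV g" "(\<integral>x. \<bar>f x - g x\<bar> \<partial>M) < e / 2"
     "continuous_on UNIV g'" "(\<integral>x. \<bar>h x - g' x\<bar> \<partial>M) < e / 2"
    using assms unfolding L1_approx_def by (meson half_gt_zero)
  note ig = integrable_continuous[OF g(1)] integrable_continuous[OF g(3)]
  have "(\<integral>x. \<bar>f x + h x - (g x + g' x)\<bar> \<partial>M) \<le> (\<integral>x. \<bar>f x - g x\<bar> + \<bar>h x - g' x\<bar> \<partial>M)"
    using i ig by (intro integral_mono) auto
  also have "\<dots> = (\<integral>x. \<bar>f x - g x\<bar> \<partial>M) + (\<integral>x. \<bar>h x - g' x\<bar> \<partial>M)"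
    using i ig by (intro Bochner_Integration.integral_add) auto
  finally show "\<exists>g. continuous_on UNIV g \<and> (\<integral>x. \<bar>f x + h x - g x\<bar> \<partial>M) < e"
    using g by (intro exI[of _ "\<lambda>x. g x + g' x"]) (auto intro!: continuous_intros)
qed

lemma L1_approx_continuous: "continuous_on UNIV f \<Longrightarrow> L1_approx f"
  unfolding L1_approx_def by (auto intro!: integrable_continuous exI[of _ f])

lemma L1_approx_cmult:
  assumes "L1_approx f"
  shows "L1_approx (\<lambda>x. c * f x)"
  unfolding L1_approx_def
proof (intro conjI allI impI)
  have i: "integrable M f" using assms unfolding L1_approx_def by auto
  then show "integrable M (\<lambda>x. c * f x)" by auto
  fix e :: real assume "e > 0"
  then obtain g where g: "continuous_on UNIV g" "(\<integral>x. \<bar>f x - g x\<bar> \<partial>M) < e / (\<bar>c\<bar> + 1)"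
    using assms unfolding L1_approx_def by (metis abs_ge_zero divide_pos_pos less_add_one order_le_less_trans)
  have "(\<integral>x. \<bar>c * f x - c * g x\<bar> \<partial>M) = \<bar>c\<bar> * (\<integral>x. \<bar>f x - g x\<bar> \<partial>M)"
    by (simp add: abs_mult flip: right_diff_distrib)
  also have "\<dots> \<le> (\<bar>c\<bar> + 1) * (\<integral>x. \<bar>f x - g x\<bar> \<partial>M)" by (intro mult_right_mono) auto
  also have "\<dots> < e" using g(2) by (simp add: field_simps)
  finally show "\<exists>g. continuous_on UNIV g \<and> (\<integral>x. \<bar>c * f x - g x\<bar> \<partial>M) < e"
    using g(1) by (intro exI[of _ "\<lambda>x. c * g x"]) (auto intro!: continuous_intros)
qed

lemma L1_approx_closed:
  assumes C: "closed C"
  shows "L1_approx (indicator C)"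
proof (cases "C = {}")
  case True
  then show ?thesis
    using L1_approx_continuous[of "\<lambda>_. 0"] by (simp add: indicator_def[abs_def])
next
  case ne: False
  have cl: "closed (circ ` C)"
    using C compact_circle continuous_circ
    by (metis compact_Int_closed compact_continuous_image compact_imp_closed continuous_on_subset
        inf_top_left top_greatest)
  define g where "g n x = max 0 (1 - real n * infdist (circ x) (circ ` C))" for n x
  show ?thesis
  proof (rule L1_approx_dominated[where s = g and b = "\<lambda>_. 1"])
    show "L1_approx (g n)" for n
      unfolding g_def by (intro L1_approx_continuous continuous_intros continuous_circ)
    show "integrable M (indicator C :: circle \<Rightarrow> real)" using C M(2) by (intro integrable_real_indicator) (auto simp: less_top[symmetric])
    show "integrable M (\<lambda>_. 1 :: real)" by simp
    show "\<bar>g n x\<bar> \<le> 1" for n x by (simp add: g_def infdist_nonneg)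
    show "(\<lambda>n. g n x) \<longlonglongrightarrow> indicator C x" for x
    proof (cases "x \<in> C")
      case True then show ?thesis by (simp add: g_def)
    next
      case False
      then have "circ x \<notin> circ ` C" using inj_circ by (auto simp: inj_def)
      then have d: "infdist (circ x) (circ ` C) > 0" (is "?d > 0")
        using cl ne by (simp add: infdist_pos_not_in_closed)
      have "eventually (\<lambda>n. real n > 1 / ?d) sequentially"
        using filterlim_real_sequentially unfolding filterlim_at_top_dense by blast
      then have "eventually (\<lambda>n. g n x = indicator C x) sequentially"
        by eventually_elim (use d False in \<open>auto simp: field_simps g_def\<close>)
      then show ?thesis by (rule tendsto_eventually)
    qed
  qed
qed

lemma integrable_indicator_borel: "A \<in> sets borel \<Longrightarrow> integrable M (indicator A :: circle \<Rightarrow> real)"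
  using M(2) by (intro integrable_real_indicator) (auto simp: less_top[symmetric])

lemma L1_approx_borel:
  assumes "A \<in> sets borel"
  shows "L1_approx (indicator A)"
proof -
  have "Int_stable {C :: circle set. closed C}" by (auto simp: Int_stable_def)
  moreover have "{C :: circle set. closed C} \<subseteq> Pow UNIV" by simp
  moreover have "A \<in> sigma_sets UNIV {C. closed C}" using assms unfolding borel_eq_closed by simp
  ultimately show ?thesis
  proof (induction rule: sigma_sets_induct_disjoint)
    case (basic A)
    then show ?case using L1_approx_closed by simp
  next
    case empty
    show ?case by (rule L1_approx_closed) simp
  next
    case (compl A)
    have "L1_approx (\<lambda>x. 1 + (-1) * indicator A x)"
      by (intro L1_approx_add L1_approx_cmult compl L1_approx_continuous continuous_intros)
    then show ?case by (rule back_subst[of L1_approx]) (auto simp: indicator_def)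
  next
    case (union F)
    have Fb: "F i \<in> sets borel" for i
    proof -
      have "F i \<in> sigma_sets UNIV {C. closed C}" using union(2) by auto
      then show ?thesis unfolding borel_eq_closed by simp
    qed
    have S: "L1_approx (\<lambda>x. \<Sum>i<n. indicator (F i) x)" for n
    proof (induction n)
      case 0
      show ?case by (simp add: L1_approx_continuous)
    next
      case (Suc n)
      then show ?case using L1_approx_add[OF _ union(3)] by simp
    qed
    have eq: "(\<Sum>i<n. indicator (F i) x) = indicator (\<Union>i<n. F i) x" for n and x
      using union(1) by (simp add: indicator_UN_disjoint disjoint_family_on_def)
    show ?case
    proof (rule L1_approx_dominated[OF S])
      show "integrable M (indicator (\<Union>i. F i) :: circle \<Rightarrow> real)"
        using Fb by (intro integrable_indicator_borel) auto
      show "integrable M (\<lambda>_. 1 :: real)" by simp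
      show "(\<lambda>n. \<Sum>i<n. indicator (F i) x) \<longlonglongrightarrow> (indicator (\<Union>i. F i) x :: real)" for x
        unfolding eq by (rule LIMSEQ_indicator_UN)
      show "\<bar>\<Sum>i<n. indicator (F i) x\<bar> \<le> (1 :: real)" for n x
        unfolding eq by (simp add: indicator_def)
    qed
  qed
qed

lemma continuous_dense_L1:
  fixes f :: "circle \<Rightarrow> real"
  assumes "integrable M f" "0 < e"
  shows "\<exists>g. continuous_on UNIV g \<and> (\<integral>x. \<bar>f x - g x\<bar> \<partial>M) < e"
proof -
  have sp: "space M = UNIV" using sets_eq_imp_space_eq[OF M(2)] by simp
  have "L1_approx f" using assms(1)
  proof (induction rule: integrable_induct)
    case (base A c)
    then have "L1_approx (\<lambda>x. c * indicator A x)" using M(2) by (intro L1_approx_cmult L1_approx_borel) auto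
    then show ?case by (simp add: mult.commute)
  next
    case (add f g)
    then show ?case by (intro L1_approx_add)
  next
    case (lim f s)
    show ?case
      by (rule L1_approx_dominated[where s = s and b = "\<lambda>x. 2 * \<bar>f x\<bar>"]) (use lim sp in auto)
  qed
  then show ?thesis using assms(2) unfolding L1_approx_def by blast
qed

end

section \<open>Averages along a good set\<close>

lemma trig_twisted_average:
  assumes R: "good_set R" and "trig g"
  shows "convergent (\<lambda>N. (\<Sum>n<N. g (echar (real (enumerate R n) * \<alpha>)) * echar (real (enumerate R n) * \<beta>)) / of_nat N)"
  using assms(2)
proof (induction rule: trig.induct)
  case (powi c k)
  have "echar (real m * \<alpha>) powi k * echar (real m * \<beta>) = echar (real m * (real_of_int k * \<alpha> + \<beta>))" for m
    by (simp add: echar_cis cis_power_int distrib_left mult_ac flip: cis_mult)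
  then have "(\<Sum>n<N. c * echar (real (enumerate R n) * \<alpha>) powi k * echar (real (enumerate R n) * \<beta>)) / of_nat N =
     c * ((\<Sum>n<N. echar (real (enumerate R n) * (real_of_int k * \<alpha> + \<beta>))) / of_nat N)" for N
    by (simp add: mult.assoc flip: sum_distrib_left)
  moreover have "convergent (\<lambda>N. (\<Sum>n<N. echar (real (enumerate R n) * (real_of_int k * \<alpha> + \<beta>))) / of_nat N)"
    using R unfolding good_set_def by blast
  ultimately show ?case by (simp only: convergent_mult convergent_const)
next
  case (add f g)
  then show ?case
    using convergent_add by (fastforce simp: sum.distrib add_divide_distrib distrib_right)
qed

lemma inverse_Suc_tendsto: "(\<lambda>j. c / real (Suc j)) \<longlonglongrightarrow> 0"
  using tendsto_mult_right_zero[OF LIMSEQ_inverse_real_of_nat, of c] by (simp add: divide_inverse)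

lemma trig_sequence:
  fixes f :: "circle \<Rightarrow> real"
  assumes "continuous_on UNIV f"
  obtains g where "\<And>j. trig (g j)" "\<And>j x. cmod (of_real (f x) - g j (circ x)) \<le> 1 / real (Suc j)"
proof -
  have "\<exists>g. trig g \<and> (\<forall>x. cmod (of_real (f x) - g (circ x)) \<le> 1 / real (Suc j))" for j
    using trig_approximation[OF assms, of "1 / real (Suc j)"] by (metis less_imp_le of_nat_0_less_iff zero_less_Suc zero_less_divide_1_iff)
  then show thesis using that by metis
qed

lemma twisted_average:
  fixes f :: "circle \<Rightarrow> real"
  assumes R: "good_set R" and f: "continuous_on UNIV f"
  shows "convergent (\<lambda>N. (\<Sum>n<N. of_real (f (to_circle (real (enumerate R n) * \<alpha>))) * echar (real (enumerate R n) * \<beta>)) / of_nat N)"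
proof -
  obtain g where g: "\<And>j. trig (g j)" "\<And>j x. cmod (of_real (f x) - g j (circ x)) \<le> 1 / real (Suc j)"
    using trig_sequence[OF f] by blast
  define v where "v j N = (\<Sum>n<N. g j (echar (real (enumerate R n) * \<alpha>)) * echar (real (enumerate R n) * \<beta>)) / of_nat N" for j N
  have "\<forall>j. \<exists>l. v j \<longlonglongrightarrow> l"
    using trig_twisted_average[OF R g(1)] unfolding convergent_def v_def by blast
  then have "\<exists>L. \<forall>j. v j \<longlonglongrightarrow> L j" by (rule choice)
  then obtain L where L: "\<And>j. v j \<longlonglongrightarrow> L j" by blast
  have "\<exists>l. (\<lambda>N. (\<Sum>n<N. of_real (f (to_circle (real (enumerate R n) * \<alpha>))) * echar (real (enumerate R n) * \<beta>)) / of_nat N) \<longlonglongrightarrow> l \<and> L \<longlonglongrightarrow> l"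
  proof (rule convergent_approx[OF L inverse_Suc_tendsto[of 1]], rule eventually_sequentiallyI[of 1])
    fix j N :: nat assume "1 \<le> N"
    define c where "c n = of_real (f (to_circle (real (enumerate R n) * \<alpha>))) - g j (echar (real (enumerate R n) * \<alpha>))" for n
    have "cmod (\<Sum>n<N. c n * echar (real (enumerate R n) * \<beta>)) \<le> (\<Sum>n<N. 1 / real (Suc j))"
    proof (rule sum_norm_le)
      fix n
      show "cmod (c n * echar (real (enumerate R n) * \<beta>)) \<le> 1 / real (Suc j)"
        using g(2)[of "to_circle (real (enumerate R n) * \<alpha>)" j]
        by (simp add: c_def norm_mult circ_to_circle)
    qed
    then have "cmod ((\<Sum>n<N. c n * echar (real (enumerate R n) * \<beta>)) / of_nat N) \<le> 1 / real (Suc j)"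
      using \<open>1 \<le> N\<close> by (simp add: norm_divide divide_simps mult.commute)
    then show "norm ((\<Sum>n<N. of_real (f (to_circle (real (enumerate R n) * \<alpha>))) * echar (real (enumerate R n) * \<beta>)) / of_nat N
       - v j N) \<le> 1 / real (Suc j)"
      by (simp add: v_def c_def left_diff_distrib sum_subtractf diff_divide_distrib)
  qed
  then show ?thesis unfolding convergent_def by blast
qed

lemma continuous_average:
  fixes f :: "circle \<Rightarrow> real"
  assumes "good_set R" "continuous_on UNIV f"
  shows "(\<lambda>N. (\<Sum>n<N. f (to_circle (real (enumerate R n) * \<alpha>))) / real N) \<longlonglongrightarrow> (\<integral>x. f x \<partial>mu R \<alpha>)"
  using mu_limit(3)[OF assms(1), of \<alpha>] assms(2) unfolding weak_limit_def by (simp add: integral_empirical)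

text \<open>
  Only \<open>L\<^sup>1\<close> approximation of the density is available, but it suffices for testing against bounded
  functions.  The geometric rate makes the consecutive differences summable.
\<close>

lemma density_approximation:
  assumes \<mu>: "prob_space \<mu>" "sets \<mu> = sets (borel :: circle measure)"
    and \<nu>: "prob_space \<nu>" "sets \<nu> = sets borel" and ac: "absolutely_continuous \<mu> \<nu>"
  obtains \<rho> :: "nat \<Rightarrow> circle \<Rightarrow> real" where "\<And>i x. 0 \<le> \<rho> i x" "\<And>i. continuous_on UNIV (\<rho> i)"
    "\<And>i. (\<integral>x. \<bar>\<rho> (Suc i) x - \<rho> i x\<bar> \<partial>\<mu>) < (1/2) ^ Suc i"
    "\<And>f :: circle \<Rightarrow> real. continuous_on UNIV f \<Longrightarrow> (\<lambda>i. \<integral>x. \<rho> i x * f x \<partial>\<mu>) \<longlonglongrightarrow> (\<integral>x. f x \<partial>\<nu>)"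
proof -
  interpret \<mu>: prob_space \<mu> by fact
  interpret \<nu>: prob_space \<nu> by fact
  have fin: "finite_measure \<mu>" "finite_measure \<nu>" by unfold_locales
  have s: "sets \<nu> = sets \<mu>" using \<mu> \<nu> by simp
  obtain D where D: "D \<in> borel_measurable \<mu>" "AE x in \<mu>. RN_deriv \<mu> \<nu> x = ennreal (D x)" "\<And>x. 0 \<le> D x"
    using \<mu>.real_RN_deriv[OF fin(2) ac s] by metis
  have "density \<mu> (RN_deriv \<mu> \<nu>) = density \<mu> D"
    using D by (intro density_cong) auto
  then have \<nu>D: "\<nu> = density \<mu> D" using \<mu>.density_RN_deriv[OF ac s] by simp
  have iD: "integrable \<mu> D"
  proof -
    have "integrable (density \<mu> D) (\<lambda>_. 1 :: real)" unfolding \<nu>D[symmetric] by simp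
    then show ?thesis using integrable_real_density[of D \<mu> "\<lambda>_. 1"] D by simp
  qed
  have "\<exists>g. continuous_on UNIV g \<and> (\<integral>x. \<bar>D x - g x\<bar> \<partial>\<mu>) < (1/2) ^ i / 4" for i
    using iD by (intro continuous_dense_L1 fin \<mu>) auto
  then obtain g where g: "\<And>i. continuous_on UNIV (g i)" "\<And>i. (\<integral>x. \<bar>D x - g i x\<bar> \<partial>\<mu>) < (1/2) ^ i / 4" by metis
  define \<rho> where "\<rho> i x = max 0 (g i x)" for i x
  have c\<rho>: "continuous_on UNIV (\<rho> i)" for i unfolding \<rho>_def by (intro continuous_intros g)
  note i\<rho> = integrable_continuous[OF fin(1) \<mu>(2) c\<rho>] and ig = integrable_continuous[OF fin(1) \<mu>(2) g(1)]
  \<comment> \<open>Truncation at 0 does not increase the distance to the nonnegative density.\<close>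
  have d: "(\<integral>x. \<bar>D x - \<rho> i x\<bar> \<partial>\<mu>) < (1/2) ^ i / 4" for i
  proof -
    have "\<bar>D x - \<rho> i x\<bar> \<le> \<bar>D x - g i x\<bar>" for x using D(3)[of x] by (simp add: \<rho>_def max_def)
    then have "(\<integral>x. \<bar>D x - \<rho> i x\<bar> \<partial>\<mu>) \<le> (\<integral>x. \<bar>D x - g i x\<bar> \<partial>\<mu>)"
      using iD i\<rho> ig by (intro integral_mono) auto
    then show ?thesis using g(2)[of i] by linarith
  qed
  show thesis
  proof (rule that[of \<rho>])
    show "0 \<le> \<rho> i x" for i x by (simp add: \<rho>_def)
    show "continuous_on UNIV (\<rho> i)" for i by (rule c\<rho>)
    show "(\<integral>x. \<bar>\<rho> (Suc i) x - \<rho> i x\<bar> \<partial>\<mu>) < (1/2) ^ Suc i" for i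
    proof -
      have "(\<integral>x. \<bar>\<rho> (Suc i) x - \<rho> i x\<bar> \<partial>\<mu>) \<le> (\<integral>x. \<bar>D x - \<rho> (Suc i) x\<bar> + \<bar>D x - \<rho> i x\<bar> \<partial>\<mu>)"
        using iD i\<rho> by (intro integral_mono) auto
      also have "\<dots> = (\<integral>x. \<bar>D x - \<rho> (Suc i) x\<bar> \<partial>\<mu>) + (\<integral>x. \<bar>D x - \<rho> i x\<bar> \<partial>\<mu>)"
        using iD i\<rho> by (intro Bochner_Integration.integral_add) auto
      also have "\<dots> < (1/2) ^ Suc i / 4 + (1/2) ^ i / 4" by (intro add_strict_mono d)
      also have "\<dots> \<le> (1/2) ^ Suc i" by simp
      finally show ?thesis .
    qed
    fix f :: "circle \<Rightarrow> real" assume f: "continuous_on UNIV f"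
    obtain B where B: "\<And>x. \<bar>f x\<bar> \<le> B" using bounded_continuous_circle[OF f] by blast
    have fm: "f \<in> borel_measurable \<mu>" using f by (rule measurable_continuous[OF fin(1) \<mu>(2)])
    have i\<rho>f: "integrable \<mu> (\<lambda>x. \<rho> i x * f x)" for i
      by (intro integrable_continuous[OF fin(1) \<mu>(2)] continuous_intros c\<rho> f)
    have iDf: "integrable \<mu> (\<lambda>x. D x * f x)"
    proof (rule Bochner_Integration.integrable_bound[of _ "\<lambda>x. B * D x"])
      show "AE x in \<mu>. norm (D x * f x) \<le> norm (B * D x)"
      proof (rule AE_I2)
        fix x show "norm (D x * f x) \<le> norm (B * D x)"
          using mult_right_mono[OF B[of x] D(3)[of x]] D(3)[of x] abs_ge_self[of "B * D x"]
          by (simp add: abs_mult mult.commute)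
      qed
    qed (use iD D fm in auto)
    have "(\<integral>x. f x \<partial>\<nu>) = (\<integral>x. D x * f x \<partial>\<mu>)"
      unfolding \<nu>D using fm D by (intro integral_real_density) auto
    moreover have "(\<lambda>i. (\<integral>x. \<rho> i x * f x \<partial>\<mu>) - (\<integral>x. D x * f x \<partial>\<mu>)) \<longlonglongrightarrow> 0"
    proof (rule Lim_null_comparison)
      show "(\<lambda>i. B * ((1/2) ^ i / 4)) \<longlonglongrightarrow> 0"
        by (intro tendsto_mult_right_zero tendsto_divide_zero LIMSEQ_power_zero) auto
      show "eventually (\<lambda>i. norm ((\<integral>x. \<rho> i x * f x \<partial>\<mu>) - (\<integral>x. D x * f x \<partial>\<mu>)) \<le> B * ((1/2) ^ i / 4)) sequentially"
      proof (rule always_eventually, rule allI)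
        fix i
        have "(\<integral>x. \<rho> i x * f x \<partial>\<mu>) - (\<integral>x. D x * f x \<partial>\<mu>) = (\<integral>x. \<rho> i x * f x - D x * f x \<partial>\<mu>)"
          using i\<rho>f iDf by (intro Bochner_Integration.integral_diff[symmetric])
        also have "norm \<dots> \<le> (\<integral>x. norm (\<rho> i x * f x - D x * f x) \<partial>\<mu>)" by (rule integral_norm_bound)
        also have "\<dots> \<le> (\<integral>x. B * \<bar>D x - \<rho> i x\<bar> \<partial>\<mu>)"
        proof (intro integral_mono)
          fix x
          have "norm (\<rho> i x * f x - D x * f x) = \<bar>f x\<bar> * \<bar>D x - \<rho> i x\<bar>"
            by (simp add: abs_mult abs_minus_commute flip: left_diff_distrib)
          also have "\<dots> \<le> B * \<bar>D x - \<rho> i x\<bar>" using B[of x] by (intro mult_right_mono) auto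
          finally show "norm (\<rho> i x * f x - D x * f x) \<le> B * \<bar>D x - \<rho> i x\<bar>" .
        qed (use i\<rho>f iDf iD i\<rho> in auto)
        also have "\<dots> = B * (\<integral>x. \<bar>D x - \<rho> i x\<bar> \<partial>\<mu>)" by simp
        also have "\<dots> \<le> B * ((1/2) ^ i / 4)"
          using d[of i] B[of undefined] by (intro mult_left_mono) auto
        finally show "norm ((\<integral>x. \<rho> i x * f x \<partial>\<mu>) - (\<integral>x. D x * f x \<partial>\<mu>)) \<le> B * ((1/2) ^ i / 4)" .
      qed
    qed
    ultimately show "(\<lambda>i. \<integral>x. \<rho> i x * f x \<partial>\<mu>) \<longlonglongrightarrow> (\<integral>x. f x \<partial>\<nu>)" by (simp add: LIM_zero_iff)
  qed
qed

section \<open>Slowly decreasing selection probabilities\<close>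

text \<open>
  Diagonalisation: \<open>k n\<close> is the largest index up to which all thresholds have been passed by time \<open>n\<close>.
\<close>

lemma slow_index:
  fixes P :: "nat \<Rightarrow> nat \<Rightarrow> bool"
  assumes "\<And>i. eventually (P i) sequentially"
  shows "\<exists>k. mono k \<and> filterlim k at_top sequentially \<and> (\<forall>n i. 0 < i \<longrightarrow> i \<le> k n \<longrightarrow> P i n)"
proof -
  have "\<forall>i. \<exists>T. \<forall>n\<ge>T. P i n" using assms unfolding eventually_sequentially by blast
  then obtain T where T: "\<And>i n. n \<ge> T i \<Longrightarrow> P i n" by metis
  define B where "B n = {k. k \<le> n \<and> (\<forall>i\<in>{1..k}. T i \<le> n)}" for n
  define k where "k n = Max (B n)" for n
  have fin: "finite (B n)" for n unfolding B_def by auto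
  have ne: "0 \<in> B n" for n unfolding B_def by auto
  have kB: "k n \<in> B n" for n unfolding k_def using fin ne by (metis Max_in empty_iff)
  have ub: "j \<le> k n" if "j \<in> B n" for j n unfolding k_def using fin that by (rule Max_ge)
  have "mono k"
  proof (rule monoI)
    fix m n :: nat assume "m \<le> n"
    then have "k m \<in> B n" using kB[of m] by (force simp: B_def)
    then show "k m \<le> k n" by (rule ub)
  qed
  moreover have "filterlim k at_top sequentially"
    unfolding filterlim_at_top
  proof
    fix K
    have "eventually (\<lambda>n. n \<ge> K + (\<Sum>i\<in>{1..K}. T i)) sequentially" by (rule eventually_ge_at_top)
    then show "eventually (\<lambda>n. K \<le> k n) sequentially"
    proof eventually_elim
      case (elim n)
      have "T i \<le> n" if "i \<in> {1..K}" for i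
        using member_le_sum[of i "{1..K}" T] that elim by auto
      then show ?case using elim by (intro ub) (auto simp: B_def)
    qed
  qed
  moreover have "P i n" if "0 < i" "i \<le> k n" for i n
    using kB[of n] that by (intro T) (auto simp: B_def)
  ultimately show ?thesis by blast
qed

text \<open>
  Here \<open>b i n\<close> stands for \<open>\<rho>\<^sub>i(x\<^sub>n)\<close> and \<open>K\<close> for the logarithmic cost of the tests.  The
  weights are the reciprocals of \<open>M (k n)\<close>, where \<open>M\<close> dominates the bounds \<open>Bd\<close>; this makes
  \<open>w n * b (k n) n\<close> a probability.  The difference \<open>b (k m) m - b j m\<close> telescopes into consecutive
  differences whose index \<open>i\<close> has been admitted only after their averages have dropped to
  \<open>(1/2) ^ i\<close>, which gives the last property.
\<close>

lemma slow_weights: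
  fixes b :: "nat \<Rightarrow> nat \<Rightarrow> real" and Bd K :: "nat \<Rightarrow> real"
  assumes b: "\<And>i n. 0 \<le> b i n" "\<And>i n. b i n \<le> Bd i"
    and diff: "\<And>i. eventually (\<lambda>n. (\<Sum>m<n. \<bar>b (Suc i) m - b i m\<bar>) \<le> (1/2) ^ Suc i * n) sequentially"
    and K: "(\<lambda>n. K n / n) \<longlonglongrightarrow> 0"
  obtains k w where "antimono w" "\<And>n. 0 < w n" "\<And>n. w n \<le> (1::real)" "w \<longlonglongrightarrow> 0"
    "\<And>n. w n * b (k n) n \<le> 1" "eventually (\<lambda>n. K n / n \<le> w n ^ 4) sequentially"
    "\<And>j. \<exists>C. \<forall>n. (\<Sum>m<n. \<bar>b (k m) m - b j m\<bar>) \<le> (1/2) ^ j * n + C"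
proof -
  have Bd: "0 \<le> Bd i" for i using b order_trans by blast
  \<comment> \<open>The summand \<open>real i\<close> forces the weights to tend to 0, the summand 1 keeps them below 1.\<close>
  define M where "M i = 1 + real i + (\<Sum>l\<le>i. Bd l)" for i
  have M: "1 + real i \<le> M i" "Bd i \<le> M i" for i
    using Bd member_le_sum[of i "{..i}" Bd] by (auto simp: M_def sum_nonneg)
  have Mpos: "0 < M i" "1 \<le> M i" for i using M(1)[of i] by linarith+
  have Mmono: "M i \<le> M l" if "i \<le> l" for i l
    unfolding M_def using that Bd by (intro add_mono sum_mono2) auto
  define P where "P i n \<longleftrightarrow> (\<Sum>m<n. \<bar>b i m - b (i - 1) m\<bar>) \<le> (1/2) ^ i * n \<and> K n / n \<le> (1 / M i) ^ 4" for i n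
  have "eventually (P i) sequentially" for i
  proof -
    have "eventually (\<lambda>n. (\<Sum>m<n. \<bar>b i m - b (i - 1) m\<bar>) \<le> (1/2) ^ i * n) sequentially"
      using diff[of "i - 1"] by (cases i) auto
    moreover have "eventually (\<lambda>n. K n / n < (1 / M i) ^ 4) sequentially"
      by (rule order_tendstoD(2)[OF K]) (use Mpos(1)[of i] in simp)
    ultimately show ?thesis unfolding P_def by eventually_elim simp
  qed
  then obtain k where k: "mono k" "filterlim k at_top sequentially"
    and Pk: "\<And>n i. 0 < i \<Longrightarrow> i \<le> k n \<Longrightarrow> P i n"
    using slow_index by blast
  define w where "w n = 1 / M (k n)" for n
  show thesis
  proof (rule that[of w k])
    show "antimono w"
      unfolding w_def antimono_def using k(1) Mmono Mpos
      by (auto intro!: divide_left_mono simp: monoD)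
    show "0 < w n" "w n \<le> 1" for n using Mpos by (simp_all add: w_def)
    have "(\<lambda>n. 1 / (1 + real (k n))) \<longlonglongrightarrow> 0"
      using filterlim_compose[OF LIMSEQ_inverse_real_of_nat k(2)] by (simp add: inverse_eq_divide)
    then show "w \<longlonglongrightarrow> 0"
    proof (rule Lim_null_comparison[rotated])
      have "norm (w n) \<le> 1 / (1 + real (k n))" for n
        using M(1)[of "k n"] Mpos(1)[of "k n"] by (simp add: w_def frac_le)
      then show "eventually (\<lambda>n. norm (w n) \<le> 1 / (1 + real (k n))) sequentially" by simp
    qed
    show "w n * b (k n) n \<le> 1" for n
      using b(2)[of "k n" n] M(2)[of "k n"] Mpos[of "k n"] by (simp add: w_def divide_simps)
    have "eventually (\<lambda>n. 1 \<le> k n) sequentially" using k(2) unfolding filterlim_at_top by blast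
    then show "eventually (\<lambda>n. K n / n \<le> w n ^ 4) sequentially"
      by eventually_elim (use Pk in \<open>force simp: P_def w_def\<close>)
    show "\<exists>C. \<forall>n. (\<Sum>m<n. \<bar>b (k m) m - b j m\<bar>) \<le> (1/2) ^ j * n + C" for j
    proof -
      have "eventually (\<lambda>n. j \<le> k n) sequentially" using k(2) unfolding filterlim_at_top by blast
      then obtain n0 where n0: "\<And>m. m \<ge> n0 \<Longrightarrow> j \<le> k m" unfolding eventually_sequentially by blast
      define h where "h i m = \<bar>b i m - b (i - 1) m\<bar>" for i m
      \<comment> \<open>The finitely many indices with \<open>k m < j\<close>, for which the telescoping sum runs the wrong way.\<close>
      define e where "e m = (if m < n0 then \<bar>b (k m) m - b j m\<bar> else 0)" for m
      have tele: "\<bar>b l m - b j m\<bar> \<le> (\<Sum>i\<in>{j<..l}. h i m)" if "j \<le> l" for l m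
        using that
      proof (induction l rule: dec_induct)
        case (step l)
        have "{j<..Suc l} = insert (Suc l) {j<..l}" using step by auto
        then show ?case using step by (simp add: h_def)
      qed simp
      have "(\<Sum>m<n. \<bar>b (k m) m - b j m\<bar>) \<le> (1/2) ^ j * n + (\<Sum>m<n0. e m)" for n
      proof -
        have "\<bar>b (k m) m - b j m\<bar> \<le> e m + (\<Sum>i\<in>{j<..k n}. h i m)" if "m < n" for m
        proof (cases "m < n0")
          case True
          then show ?thesis by (simp add: e_def h_def sum_nonneg)
        next
          case False
          have "(\<Sum>i\<in>{j<..k m}. h i m) \<le> (\<Sum>i\<in>{j<..k n}. h i m)"
            using monoD[OF k(1), of m n] that by (intro sum_mono2) (auto simp: h_def)
          then show ?thesis using tele[OF n0, of m m] False by (simp add: e_def)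
        qed
        then have "(\<Sum>m<n. \<bar>b (k m) m - b j m\<bar>) \<le> (\<Sum>m<n. e m + (\<Sum>i\<in>{j<..k n}. h i m))"
          by (intro sum_mono) auto
        also have "\<dots> = (\<Sum>m<n. e m) + (\<Sum>i\<in>{j<..k n}. \<Sum>m<n. h i m)"
          unfolding sum.distrib by (subst sum.swap) simp
        also have "(\<Sum>m<n. e m) \<le> (\<Sum>m<max n n0. e m)"
          by (intro sum_mono2) (auto simp: e_def)
        also have "(\<Sum>m<max n n0. e m) = (\<Sum>m<n0. e m)"
          by (intro sum.mono_neutral_right) (auto simp: e_def)
        also have "(\<Sum>i\<in>{j<..k n}. \<Sum>m<n. h i m) \<le> (\<Sum>i\<in>{j<..k n}. (1/2) ^ i * n)"
          using Pk[of _ n] by (intro sum_mono) (auto simp: P_def h_def)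
        also have "\<dots> = (\<Sum>i\<in>{j<..k n}. (1/2) ^ i) * real n" by (simp add: sum_distrib_right)
        also have "\<dots> \<le> (1/2) ^ j * n"
        proof (rule mult_right_mono)
          have "(\<Sum>i\<in>{j<..l}. (1/2) ^ i) \<le> (1/2 :: real) ^ j - (1/2) ^ l" if "j \<le> l" for l
            using that
          proof (induction l rule: dec_induct)
            case (step l)
            have "{j<..Suc l} = insert (Suc l) {j<..l}" using step by auto
            then show ?case using step by simp
          qed simp
          from this[of "k n"] show "(\<Sum>i\<in>{j<..k n}. (1/2) ^ i) \<le> (1/2 :: real) ^ j"
            by (cases "j \<le> k n") (auto intro: order_trans)
        qed simp
        finally show ?thesis by (simp add: add.commute)
      qed
      then show ?thesis by blast
    qed
  qed
qed

text \<open>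
  With the parameter \<open>lam N = (w N)\<^sup>2\<close> the deviation is of order \<open>(w N)\<^sup>2 N + K N / (w N)\<^sup>2\<close>.  Since
  \<open>K N / N \<le> w N ^ 4\<close> this is \<open>O((w N)\<^sup>2 N)\<close>, and the total weight is at least \<open>N * w N\<close>.
\<close>

lemma selection_exists:
  fixes b :: "nat \<Rightarrow> nat \<Rightarrow> real" and r :: "nat \<Rightarrow> nat"
  assumes r: "mono r" "\<And>n. n \<le> r n" "\<And>n. 1 \<le> r n" "(\<lambda>n. ln (real (r n)) / n) \<longlonglongrightarrow> 0"
    and b: "\<And>i n. 0 \<le> b i n" "\<And>i n. b i n \<le> Bd i"
    and diff: "\<And>i. eventually (\<lambda>n. (\<Sum>m<n. \<bar>b (Suc i) m - b i m\<bar>) \<le> (1/2) ^ Suc i * n) sequentially"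
  obtains A k w where "antimono w" "\<And>n. 0 < (w n :: real)" "filterlim (\<lambda>N. \<Sum>n<N. w n) at_top sequentially"
    "\<And>j. \<exists>C. \<forall>n. (\<Sum>m<n. \<bar>b (k m) m - b j m\<bar>) \<le> (1/2) ^ j * n + C"
    "\<And>\<beta>. (\<lambda>N. (\<Sum>n<N. of_real (indicator A n - w n * b (k n) n) * echar (real (r n) * \<beta>)) /
        of_real (\<Sum>n<N. w n)) \<longlonglongrightarrow> 0"
proof -
  define K where "K n = 16 * ln (real (r n)) + 20" for n
  have K20: "20 \<le> K n" for n using r(3)[of n] by (simp add: K_def)
  have "(\<lambda>n. 16 * (ln (real (r n)) / n) + 20 / real n) \<longlonglongrightarrow> 16 * 0 + 0"
    by (intro tendsto_intros r lim_const_over_n)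
  then have K0: "(\<lambda>n. K n / n) \<longlonglongrightarrow> 0" by (simp add: K_def add_divide_distrib)
  obtain k w where w: "antimono w" "\<And>n. 0 < w n" "\<And>n. w n \<le> (1::real)" "w \<longlonglongrightarrow> 0"
    and wb: "\<And>n. w n * b (k n) n \<le> 1" and Kw: "eventually (\<lambda>n. K n / n \<le> w n ^ 4) sequentially"
    and tail: "\<And>j. \<exists>C. \<forall>n. (\<Sum>m<n. \<bar>b (k m) m - b j m\<bar>) \<le> (1/2) ^ j * n + C"
    using b diff K0 by (rule slow_weights) (rule that)
  define W where "W N = (\<Sum>n<N. w n)" for N
  have W: "N * w N \<le> W N" for N
  proof -
    have "(\<Sum>n<N. w N) \<le> W N" unfolding W_def using w(1) by (intro sum_mono) (auto simp: antimono_def)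
    then show ?thesis by simp
  qed
  have WK: "eventually (\<lambda>N. K N / w N ^ 2 \<le> w N ^ 2 * N \<and> K N \<le> W N \<and> 0 < N) sequentially"
    using Kw eventually_gt_at_top[of 0]
  proof eventually_elim
    case (elim N)
    then have a: "K N \<le> w N ^ 4 * N" by (simp add: field_simps)
    have "w N ^ 4 * N \<le> w N ^ 1 * N"
      using w(2)[of N] w(3)[of N] by (intro mult_right_mono power_decreasing) auto
    then have "K N \<le> W N" using a W[of N] by (simp add: mult.commute)
    moreover have e: "w N ^ 4 * N = (w N ^ 2 * N) * w N ^ 2" by (simp add: mult_ac flip: power_add)
    have "K N / w N ^ 2 \<le> w N ^ 2 * N"
      using a[unfolded e] w(2)[of N] by (subst pos_divide_le_eq) auto
    ultimately show ?case using elim by simp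
  qed
  have "filterlim (\<lambda>N. ln (real N)) at_top sequentially"
    by (intro filterlim_compose[OF ln_at_top] filterlim_real_sequentially)
  then have Wlim: "filterlim W at_top sequentially"
  proof (rule filterlim_at_top_mono)
    show "eventually (\<lambda>N. ln (real N) \<le> W N) sequentially"
      using WK
    proof eventually_elim
      case (elim N)
      have "ln (real N) \<le> ln (real (r N))" using r(2)[of N] elim by (subst ln_le_cancel_iff) auto
      moreover have "0 \<le> ln (real (r N))" using r(3)[of N] by simp
      ultimately show ?case using elim unfolding K_def by linarith
    qed
  qed
  have wk: "0 \<le> w n * b (k n) n" for n using w(2)[of n] b(1) by (simp add: less_imp_le)
  have l: "0 < (w n)\<^sup>2" "(w n)\<^sup>2 \<le> 1" for n using w(2)[of n] w(3)[of n] by (auto simp: power_le_one less_imp_le)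
  obtain A where A: "\<And>N \<beta>. cmod (\<Sum>m<N. of_real (indicator A m - w m * b (k m) m) * echar (real (r m) * \<beta>))
      \<le> 2 * ((w N)\<^sup>2 * N + K N / (w N)\<^sup>2) + 2 * pi"
    using uniform_selection[of r "\<lambda>n. w n * b (k n) n" "\<lambda>n. (w n)\<^sup>2", OF r(1-3) wk wb l] unfolding K_def by blast
  have "(\<lambda>N. (\<Sum>n<N. of_real (indicator A n - w n * b (k n) n) * echar (real (r n) * \<beta>)) / of_real (W N)) \<longlonglongrightarrow> 0" for \<beta>
  proof (rule Lim_null_comparison)
    show "(\<lambda>N. 5 * w N) \<longlonglongrightarrow> 0" using tendsto_mult_right_zero[OF w(4)] by simp
    show "eventually (\<lambda>N. norm ((\<Sum>n<N. of_real (indicator A n - w n * b (k n) n) * echar (real (r n) * \<beta>)) / of_real (W N)) \<le> 5 * w N) sequentially"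
      using WK
    proof eventually_elim
      case (elim N)
      have "2 * pi \<le> K N" using K20[of N] pi_less_4 by linarith
      also have "K N \<le> K N / (w N)\<^sup>2" using K20[of N] l[of N] by (simp add: field_simps mult_left_le)
      finally have "cmod (\<Sum>m<N. of_real (indicator A m - w m * b (k m) m) * echar (real (r m) * \<beta>)) \<le> 5 * ((w N)\<^sup>2 * N)"
        using A[of \<beta> N] conjunct1[OF elim] unfolding distrib_left by linarith
      also have "\<dots> = 5 * w N * (N * w N)" by (simp add: power2_eq_square)
      also have "\<dots> \<le> 5 * w N * W N" using W[of N] w(2)[of N] by (intro mult_left_mono) auto
      finally show ?case using elim K20[of N] by (simp add: norm_divide divide_simps)
    qed
  qed
  with w Wlim tail show thesis unfolding W_def by (intro that) auto
qed

text \<open>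
  The rate at which the averages for a fixed \<open>j\<close> converge is irrelevant.  The passage from \<open>j\<close> to
  \<open>k n\<close> is controlled by \<open>tail\<close> independently of \<open>a\<close>.
\<close>

lemma diagonal_average:
  fixes b :: "nat \<Rightarrow> nat \<Rightarrow> real" and a :: "nat \<Rightarrow> complex"
  assumes w: "antimono w" "\<And>n. 0 < w n" and W: "filterlim (\<lambda>N. \<Sum>n<N. w n) at_top sequentially"
    and tail: "\<And>j. \<exists>C. \<forall>n. (\<Sum>m<n. \<bar>b (k m) m - b j m\<bar>) \<le> (1/2) ^ j * n + C"
    and a: "\<And>n. cmod (a n) \<le> B"
    and L: "\<And>j. (\<lambda>N. (\<Sum>n<N. of_real (b j n) * a n) / of_nat N) \<longlonglongrightarrow> L j"
  shows "\<exists>l. (\<lambda>N. (\<Sum>n<N. of_real (w n * b (k n) n) * a n) / of_real (\<Sum>n<N. w n)) \<longlonglongrightarrow> l \<and> L \<longlonglongrightarrow> l"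
proof -
  have B: "0 \<le> B" using a[of 0] norm_ge_zero order_trans by blast
  show ?thesis
  proof (rule convergent_approx[where E = "\<lambda>j. B * (2 * (1/2) ^ j)"])
    show "(\<lambda>N. (\<Sum>n<N. of_real (w n) * (of_real (b j n) * a n)) / of_real (\<Sum>n<N. w n)) \<longlonglongrightarrow> L j" for j
      using weighted_average_tendsto[OF w W L] .
    show "(\<lambda>j. B * (2 * (1/2) ^ j)) \<longlonglongrightarrow> 0"
      by (intro tendsto_mult_right_zero LIMSEQ_power_zero) auto
    fix j
    obtain C where C: "\<And>n. (\<Sum>m<n. \<bar>b (k m) m - b j m\<bar>) \<le> (1/2) ^ j * n + C" using tail by blast
    have "eventually (\<lambda>N. max 1 (C * w 0 / (1/2) ^ j) \<le> (\<Sum>n<N. w n)) sequentially"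
      using W unfolding filterlim_at_top by blast
    then show "eventually (\<lambda>N. norm ((\<Sum>n<N. of_real (w n * b (k n) n) * a n) / of_real (\<Sum>n<N. w n)
        - (\<Sum>n<N. of_real (w n) * (of_real (b j n) * a n)) / of_real (\<Sum>n<N. w n)) \<le> B * (2 * (1/2) ^ j)) sequentially"
    proof eventually_elim
      case (elim N)
      define S where "S = (\<Sum>n<N. w n)"
      define h :: real where "h = (1/2) ^ j"
      have h: "0 < h" by (simp add: h_def)
      have pos: "S > 0" using elim unfolding S_def by linarith
      have "(\<Sum>n<N. of_real (w n * b (k n) n) * a n) / of_real (\<Sum>n<N. w n)
        - (\<Sum>n<N. of_real (w n) * (of_real (b j n) * a n)) / of_real (\<Sum>n<N. w n)
        = (\<Sum>n<N. of_real (w n * (b (k n) n - b j n)) * a n) / of_real (\<Sum>n<N. w n)"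
        by (simp add: algebra_simps sum_subtractf diff_divide_distrib)
      also have "norm \<dots> = cmod (\<Sum>n<N. of_real (w n * (b (k n) n - b j n)) * a n) / (\<Sum>n<N. w n)"
        using pos unfolding S_def by (simp add: norm_divide del: of_real_sum)
      also have "\<dots> \<le> (B * (\<Sum>n<N. w n * \<bar>b (k n) n - b j n\<bar>)) / (\<Sum>n<N. w n)"
      proof (intro divide_right_mono)
        have "cmod (of_real (w n * (b (k n) n - b j n)) * a n) \<le> B * (w n * \<bar>b (k n) n - b j n\<bar>)" for n
          using mult_right_mono[OF a[of n], of "w n * \<bar>b (k n) n - b j n\<bar>"] w(2)[of n]
          by (simp add: norm_mult abs_mult mult.commute del: of_real_mult of_real_diff)
        then show "cmod (\<Sum>n<N. of_real (w n * (b (k n) n - b j n)) * a n) \<le> B * (\<Sum>n<N. w n * \<bar>b (k n) n - b j n\<bar>)"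
          unfolding sum_distrib_left by (intro sum_norm_le)
      qed (use pos in \<open>auto simp: S_def\<close>)
      also have "\<dots> \<le> (B * (2 * h * S)) / S"
      proof -
        have "(\<Sum>n<N. w n * \<bar>b (k n) n - b j n\<bar>) \<le> h * S + C * w 0"
          unfolding S_def h_def using w C by (intro weighted_sum_le) (auto simp: less_imp_le)
        moreover have "C * w 0 \<le> S * h"
          using elim pos_divide_le_eq[OF h, of "C * w 0" S] by (simp add: h_def S_def)
        ultimately have "(\<Sum>n<N. w n * \<bar>b (k n) n - b j n\<bar>) \<le> 2 * h * S" by (simp add: mult.commute)
        then show ?thesis unfolding S_def[symmetric] using pos B by (intro divide_right_mono mult_left_mono) auto
      qed
      also have "\<dots> = B * (2 * h)" using pos by simp
      finally show ?case unfolding h_def .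
    qed
  qed
qed

text \<open>
  The characters at multiples of \<open>\<alpha>\<close> give all trigonometric polynomials in \<open>r\<^sub>n \<alpha>\<close>; the bound on
  the total variation of \<open>d\<close> then allows uniform approximation.
\<close>

lemma selection_continuous:
  fixes f :: "circle \<Rightarrow> real" and d :: "nat \<Rightarrow> real"
  assumes disc: "\<And>\<beta>. (\<lambda>N. (\<Sum>n<N. of_real (d n) * echar (real (r n) * \<beta>)) / of_real (W N)) \<longlonglongrightarrow> 0"
    and f: "continuous_on UNIV f"
    and bound: "eventually (\<lambda>N. (\<Sum>n<N. \<bar>d n\<bar>) \<le> 3 * W N \<and> 0 < W N) sequentially"
  shows "(\<lambda>N. (\<Sum>n<N. of_real (d n) * of_real (f (to_circle (real (r n) * \<alpha>)))) / complex_of_real (W N)) \<longlonglongrightarrow> 0"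
proof -
  have trig: "(\<lambda>N. (\<Sum>n<N. of_real (d n) * g (echar (real (r n) * \<alpha>))) / of_real (W N)) \<longlonglongrightarrow> 0" if "trig g" for g
    using that
  proof (induction rule: trig.induct)
    case (powi c k)
    have "echar (real m * \<alpha>) powi k = echar (real m * (real_of_int k * \<alpha>))" for m
      by (simp add: echar_cis cis_power_int mult_ac)
    then have eq: "(\<Sum>n<N. of_real (d n) * (c * echar (real (r n) * \<alpha>) powi k)) / of_real (W N)
       = c * ((\<Sum>n<N. of_real (d n) * echar (real (r n) * (real_of_int k * \<alpha>))) / of_real (W N))" for N
      by (simp add: mult.left_commute flip: sum_distrib_left)
    show ?case unfolding eq by (intro tendsto_mult_right_zero disc)
  next
    case (add f g)
    then show ?case using tendsto_add[OF add.IH] by (simp add: sum.distrib add_divide_distrib distrib_left)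
  qed
  obtain g where g: "\<And>j. trig (g j)" "\<And>j x. cmod (of_real (f x) - g j (circ x)) \<le> 1 / real (Suc j)"
    using trig_sequence[OF f] by blast
  have "\<exists>l. (\<lambda>N. (\<Sum>n<N. of_real (d n) * of_real (f (to_circle (real (r n) * \<alpha>)))) / complex_of_real (W N)) \<longlonglongrightarrow> l
      \<and> (\<lambda>j::nat. 0) \<longlonglongrightarrow> l"
  proof (rule convergent_approx[OF trig[OF g(1)] inverse_Suc_tendsto[of 3]])
    fix j
    show "eventually (\<lambda>N. norm ((\<Sum>n<N. of_real (d n) * of_real (f (to_circle (real (r n) * \<alpha>)))) / complex_of_real (W N)
        - (\<Sum>n<N. of_real (d n) * g j (echar (real (r n) * \<alpha>))) / of_real (W N)) \<le> 3 / real (Suc j)) sequentially"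
      using bound
    proof eventually_elim
      case (elim N)
      define c where "c n = of_real (f (to_circle (real (r n) * \<alpha>))) - g j (echar (real (r n) * \<alpha>))" for n
      have c: "cmod (c n) \<le> 1 / real (Suc j)" for n
        using g(2)[of "to_circle (real (r n) * \<alpha>)" j] by (simp add: c_def circ_to_circle)
      have "cmod (\<Sum>n<N. of_real (d n) * c n) \<le> (\<Sum>n<N. \<bar>d n\<bar> * (1 / real (Suc j)))"
      proof (rule sum_norm_le)
        fix n show "cmod (of_real (d n) * c n) \<le> \<bar>d n\<bar> * (1 / real (Suc j))"
          unfolding norm_mult norm_of_real by (intro mult_left_mono c) simp
      qed
      also have "\<dots> = (\<Sum>n<N. \<bar>d n\<bar>) * (1 / real (Suc j))" by (simp only: sum_distrib_right)
      also have "\<dots> \<le> 3 * W N * (1 / real (Suc j))" using elim by (intro mult_right_mono) auto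
      finally have "cmod ((\<Sum>n<N. of_real (d n) * c n) / of_real (W N)) \<le> 3 / real (Suc j)"
        using elim by (simp add: norm_divide pos_divide_le_eq mult.commute)
      then show ?case by (simp add: c_def right_diff_distrib sum_subtractf diff_divide_distrib)
    qed
  qed
  then show ?thesis using LIMSEQ_unique[OF tendsto_const] by auto
qed

section \<open>Averages over the selected terms\<close>

lemma enumerate_eqI:
  fixes S :: "nat set"
  assumes f: "strict_mono f" and r: "range f = S"
  shows "enumerate S = f"
proof -
  have inf: "infinite S" using f r by (metis finite_imageD infinite_UNIV_nat strict_mono_imp_inj_on)
  show ?thesis
  proof
    fix n show "enumerate S n = f n"
    proof (induction n rule: less_induct)
      case (less n)
      have ge: "f n \<le> enumerate S n"
      proof -
        obtain m where m: "enumerate S n = f m" using enumerate_in_set[OF inf, of n] r by auto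
        have "\<not> m < n"
        proof
          assume "m < n"
          then have "enumerate S n = enumerate S m" using less m by simp
          then show False using \<open>m < n\<close> enumerate_mono[OF _ inf, of m n] by simp
        qed
        then show ?thesis using m f by (simp add: strict_mono_less_eq)
      qed
      moreover have "enumerate S n \<le> f n"
      proof -
        obtain m where m: "f n = enumerate S m" using enumerate_Ex[of S "f n"] inf r by (metis rangeI)
        have "\<not> m < n"
        proof
          assume "m < n"
          then have "f n = f m" using less m by simp
          then show False using \<open>m < n\<close> f by (simp add: strict_mono_eq)
        qed
        then show ?thesis using m inf by (metis enumerate_mono le_less not_less)
      qed
      ultimately show ?case by simp
    qed
  qed
qed

lemma sum_enumerate:
  fixes c :: "nat \<Rightarrow> 'a::real_normed_algebra_1"
  assumes "infinite A"
  shows "(\<Sum>k<K. c (enumerate A k)) = (\<Sum>n<enumerate A K. of_real (indicator A n) * c n)"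
proof -
  have "(\<Sum>n<enumerate A K. of_real (indicator A n) * c n) = (\<Sum>n\<in>enumerate A ` {..<K}. of_real (indicator A n) * c n)"
  proof (intro sum.mono_neutral_right ballI)
    show "enumerate A ` {..<K} \<subseteq> {..<enumerate A K}" using assms by auto
    fix n assume n: "n \<in> {..<enumerate A K} - enumerate A ` {..<K}"
    have "n \<notin> A"
    proof
      assume "n \<in> A"
      then obtain l where "n = enumerate A l" using enumerate_Ex[OF assms] by blast
      then show False using n assms by auto
    qed
    then show "of_real (indicator A n) * c n = 0" by simp
  qed simp
  also have "\<dots> = (\<Sum>k<K. of_real (indicator A (enumerate A k)) * c (enumerate A k))"
    using assms by (subst sum.reindex) (auto simp: strict_mono_imp_inj_on[OF strict_mono_enumerate] o_def)
  also have "\<dots> = (\<Sum>k<K. c (enumerate A k))"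
    using enumerate_in_set[OF assms] by simp
  finally show ?thesis by simp
qed

lemma infinite_selection:
  assumes W: "filterlim W at_top sequentially"
    and A: "(\<lambda>N. (\<Sum>n<N. indicator A n) / W N) \<longlonglongrightarrow> (1::real)"
  shows "infinite (A :: nat set)"
proof
  assume fin: "finite A"
  have "(\<lambda>N. (\<Sum>n<N. indicator A n) / W N) \<longlonglongrightarrow> 0"
  proof (rule Lim_null_comparison)
    show "(\<lambda>N. card A / W N) \<longlonglongrightarrow> 0"
      using tendsto_mult_right_zero[OF tendsto_inverse_0_at_top[OF W]] by (simp add: divide_inverse)
    have "eventually (\<lambda>N. W N > 0) sequentially" using W by (simp add: filterlim_at_top_dense)
    then show "eventually (\<lambda>N. norm ((\<Sum>n<N. indicator A n) / W N) \<le> card A / W N) sequentially"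
    proof eventually_elim
      case (elim N)
      have "(\<Sum>n<N. indicator A n :: real) = card ({..<N} \<inter> A)" by (simp add: indicator_def)
      also have "\<dots> \<le> card A" using fin by (simp add: card_mono)
      finally show ?case using elim by (simp add: sum_nonneg divide_right_mono)
    qed
  qed
  from LIMSEQ_unique[OF A this] show False by simp
qed

text \<open>
  An average over the selected terms is a ratio of two sums over all indices, taken along the
  subsequence at which new terms are selected; numerator and denominator are both normalised by \<open>W\<close>.
\<close>

lemma selected_average:
  fixes c :: "nat \<Rightarrow> complex"
  assumes W: "filterlim W at_top sequentially"
    and A: "(\<lambda>N. (\<Sum>n<N. indicator A n) / W N) \<longlonglongrightarrow> (1::real)"
    and l: "(\<lambda>N. (\<Sum>n<N. of_real (indicator A n) * c n) / of_real (W N)) \<longlonglongrightarrow> l"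
  shows "(\<lambda>K. (\<Sum>k<K. c (enumerate A k)) / of_nat K) \<longlonglongrightarrow> l"
proof -
  have inf: "infinite A" using W A by (rule infinite_selection)
  define T where "T N = (\<Sum>n<N. of_real (indicator A n) * c n)" for N
  define Q where "Q N = (\<Sum>n<N. indicator A n :: real)" for N
  have "(\<lambda>N. (T N / of_real (W N)) / of_real (Q N / W N)) \<longlonglongrightarrow> l / of_real 1"
    using l A unfolding T_def Q_def by (intro tendsto_divide tendsto_of_real) auto
  moreover have "eventually (\<lambda>N. W N > 0) sequentially" using W by (simp add: filterlim_at_top_dense)
  then have "eventually (\<lambda>N. (T N / of_real (W N)) / of_real (Q N / W N) = T N / of_real (Q N)) sequentially"
    by eventually_elim simp
  ultimately have "(\<lambda>N. T N / of_real (Q N)) \<longlonglongrightarrow> l / of_real 1"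
    by (rule Lim_transform_eventually)
  then have lim: "(\<lambda>N. T N / of_real (Q N)) \<longlonglongrightarrow> l" by simp
  have "filterlim (enumerate A) at_top sequentially"
    using strict_mono_enumerate[OF inf] by (rule filterlim_subseq)
  from filterlim_compose[OF lim this]
  have "(\<lambda>K. T (enumerate A K) / of_real (Q (enumerate A K))) \<longlonglongrightarrow> l" .
  moreover have "Q (enumerate A K) = real K" for K
    using sum_enumerate[OF inf, of "\<lambda>_. 1 :: real" K] by (simp add: Q_def)
  ultimately show ?thesis by (simp add: T_def sum_enumerate[OF inf])
qed

section \<open>Representing absolutely continuous measures\<close>

theorem mainTheorem5:
  fixes R :: "nat set" and \<alpha> :: real and \<nu> :: "circle measure"
  assumes "good_set R" and "sublacunary R"
    and "\<alpha> \<notin> \<rat>"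
    and "prob_space \<nu>" and "sets \<nu> = sets borel"
    and "absolutely_continuous (mu R \<alpha>) \<nu>"
  shows "\<exists>S. good_set S \<and> S \<subseteq> R \<and> mu S \<alpha> = \<nu>"
proof -
  define \<mu> where "\<mu> = mu R \<alpha>"
  define r where "r = enumerate R"
  define x where "x n = to_circle (real (r n) * \<alpha>)" for n
  interpret \<nu>: prob_space \<nu> by fact
  have R: "infinite R" "0 \<notin> R" using assms(1) by (auto simp: good_set_def)
  have sm: "strict_mono r" unfolding r_def using R(1) by (rule strict_mono_enumerate)
  have rR: "r n \<in> R" for n unfolding r_def using R(1) by (rule enumerate_in_set)
  have r1: "1 \<le> r n" for n using rR[of n] R(2) by (metis One_nat_def Suc_leI gr0I)
  have rn: "n \<le> r n" for n unfolding r_def using R(1) by (rule le_enumerate)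
  have mu: "prob_space \<mu>" "sets \<mu> = sets borel" unfolding \<mu>_def using mu_limit[OF assms(1)] by auto
  have ac: "absolutely_continuous \<mu> \<nu>" using assms(6) by (simp add: \<mu>_def)
  obtain \<rho> :: "nat \<Rightarrow> circle \<Rightarrow> real" where \<rho>: "\<And>i x. 0 \<le> \<rho> i x" "\<And>i. continuous_on UNIV (\<rho> i)"
    "\<And>i. (\<integral>x. \<bar>\<rho> (Suc i) x - \<rho> i x\<bar> \<partial>\<mu>) < (1/2) ^ Suc i"
    "\<And>f :: circle \<Rightarrow> real. continuous_on UNIV f \<Longrightarrow> (\<lambda>i. \<integral>x. \<rho> i x * f x \<partial>\<mu>) \<longlonglongrightarrow> (\<integral>x. f x \<partial>\<nu>)"
    using mu assms(4,5) ac by (rule density_approximation) (rule that)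
  define b where "b i n = \<rho> i (x n)" for i n
  have "\<exists>B. \<forall>x. \<bar>\<rho> i x\<bar> \<le> B" for i using bounded_continuous_circle[OF \<rho>(2)] by metis
  then obtain Bd where Bd: "\<And>i x. \<bar>\<rho> i x\<bar> \<le> Bd i" by metis
  have b: "0 \<le> b i n" "b i n \<le> Bd i" for i n
    using \<rho>(1) abs_le_D1[OF Bd] by (simp_all add: b_def)
  have avg: "(\<lambda>N. (\<Sum>n<N. f (x n)) / real N) \<longlonglongrightarrow> (\<integral>x. f x \<partial>\<mu>)" if "continuous_on UNIV f" for f :: "circle \<Rightarrow> real"
    unfolding x_def r_def \<mu>_def using assms(1) that by (rule continuous_average)
  have diff: "eventually (\<lambda>n. (\<Sum>m<n. \<bar>b (Suc i) m - b i m\<bar>) \<le> (1/2) ^ Suc i * n) sequentially" for i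
  proof -
    have "(\<lambda>N. (\<Sum>m<N. \<bar>b (Suc i) m - b i m\<bar>) / real N) \<longlonglongrightarrow> (\<integral>x. \<bar>\<rho> (Suc i) x - \<rho> i x\<bar> \<partial>\<mu>)"
      unfolding b_def by (intro avg continuous_intros \<rho>)
    from order_tendstoD(2)[OF this \<rho>(3)] eventually_gt_at_top[of 0]
    show ?thesis by eventually_elim (simp add: pos_divide_less_eq less_imp_le)
  qed
  have log: "(\<lambda>n. ln (real (r n)) / n) \<longlonglongrightarrow> 0"
    unfolding r_def using R assms(2) by (rule sublacunary_log_growth)
  obtain A k w where w: "antimono w" "\<And>n. 0 < (w n :: real)"
    and Wlim: "filterlim (\<lambda>N. \<Sum>n<N. w n) at_top sequentially"
    and tail: "\<And>j. \<exists>C. \<forall>n. (\<Sum>m<n. \<bar>b (k m) m - b j m\<bar>) \<le> (1/2) ^ j * n + C"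
    and disc: "\<And>\<beta>. (\<lambda>N. (\<Sum>n<N. of_real (indicator A n - w n * b (k n) n) * echar (real (r n) * \<beta>)) /
        of_real (\<Sum>n<N. w n)) \<longlonglongrightarrow> 0"
    using strict_mono_mono[OF sm] rn r1 log b diff by (rule selection_exists) (rule that)
  define W where "W N = (\<Sum>n<N. w n)" for N
  define p where "p n = w n * b (k n) n" for n
  note Wlim = Wlim[folded W_def] and disc = disc[folded W_def p_def]
  have Wpos: "eventually (\<lambda>N. W N > 0) sequentially" using Wlim by (simp add: filterlim_at_top_dense)
  have diag: "\<exists>l. (\<lambda>N. (\<Sum>n<N. of_real (p n) * a n) / of_real (W N)) \<longlonglongrightarrow> l \<and> L \<longlonglongrightarrow> l"
    if "\<And>n. cmod (a n) \<le> B" "\<And>j. (\<lambda>N. (\<Sum>n<N. of_real (b j n) * a n) / of_nat N) \<longlonglongrightarrow> L j" for a B L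
    unfolding p_def W_def using diagonal_average[where w = w and b = b and k = k and a = a and L = L and B = B] w Wlim tail that
    unfolding W_def by blast
  have cont: "(\<lambda>N. (\<Sum>n<N. of_real (p n) * of_real (f (x n))) / of_real (W N)) \<longlonglongrightarrow> complex_of_real (\<integral>x. f x \<partial>\<nu>)"
    if f: "continuous_on UNIV f" for f :: "circle \<Rightarrow> real"
  proof -
    obtain B where B: "\<And>x. \<bar>f x\<bar> \<le> B" using bounded_continuous_circle[OF f] by blast
    have "(\<lambda>N. (\<Sum>n<N. of_real (b j n) * of_real (f (x n))) / of_nat N) \<longlonglongrightarrow> complex_of_real (\<integral>x. \<rho> j x * f x \<partial>\<mu>)" for j
    proof -
      have "(\<lambda>N. complex_of_real ((\<Sum>n<N. \<rho> j (x n) * f (x n)) / real N)) \<longlonglongrightarrow> complex_of_real (\<integral>x. \<rho> j x * f x \<partial>\<mu>)"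
        by (intro tendsto_of_real avg continuous_intros \<rho> f)
      then show ?thesis by (simp add: b_def)
    qed
    then obtain l where l: "(\<lambda>N. (\<Sum>n<N. of_real (p n) * of_real (f (x n))) / of_real (W N)) \<longlonglongrightarrow> l"
      "(\<lambda>j. complex_of_real (\<integral>x. \<rho> j x * f x \<partial>\<mu>)) \<longlonglongrightarrow> l"
      using diag[of "\<lambda>n. of_real (f (x n))" B] B by fastforce
    have "l = complex_of_real (\<integral>x. f x \<partial>\<nu>)"
      using LIMSEQ_unique[OF l(2) tendsto_of_real[OF \<rho>(4)[OF f]]] .
    then show ?thesis using l by simp
  qed
  \<comment> \<open>The constant function 1 shows that the expected number of selected terms is asymptotic to \<open>W\<close>,
      and the discrepancy at frequency 0 transfers this to the actual number.\<close>
  have p1: "(\<lambda>N. (\<Sum>n<N. p n) / W N) \<longlonglongrightarrow> 1"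
  proof -
    have "(\<lambda>N. complex_of_real ((\<Sum>n<N. p n) / W N)) \<longlonglongrightarrow> complex_of_real 1"
      using cont[of "\<lambda>_. 1"] \<nu>.prob_space by simp
    then show ?thesis unfolding tendsto_of_real_iff .
  qed
  have A1: "(\<lambda>N. (\<Sum>n<N. indicator A n) / W N) \<longlonglongrightarrow> (1::real)"
  proof -
    have "(\<lambda>N. complex_of_real ((\<Sum>n<N. indicator A n - p n) / W N)) \<longlonglongrightarrow> complex_of_real 0"
      using disc[of 0] by (simp add: echar_quarters)
    then have "(\<lambda>N. (\<Sum>n<N. indicator A n - p n) / W N) \<longlonglongrightarrow> 0" unfolding tendsto_of_real_iff .
    from tendsto_add[OF this p1] show ?thesis
      by (simp add: sum_subtractf diff_divide_distrib)
  qed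
  have bound: "eventually (\<lambda>N. (\<Sum>n<N. \<bar>indicator A n - p n\<bar>) \<le> 3 * W N \<and> 0 < W N) sequentially"
  proof -
    have "eventually (\<lambda>N. (\<Sum>n<N. p n) / W N < 3 / 2) sequentially"
      "eventually (\<lambda>N. (\<Sum>n<N. indicator A n) / W N < (3 / 2 :: real)) sequentially"
      using order_tendstoD(2)[OF p1, of "3/2"] order_tendstoD(2)[OF A1, of "3/2"] by auto
    then show ?thesis using Wpos
    proof eventually_elim
      case (elim N)
      have "(\<Sum>n<N. \<bar>indicator A n - p n\<bar>) \<le> (\<Sum>n<N. indicator A n + p n)"
      proof (rule sum_mono)
        fix n
        have "0 \<le> p n" using w(2)[of n] b(1) by (simp add: p_def less_imp_le)
        then show "\<bar>indicator A n - p n\<bar> \<le> indicator A n + p n" by (cases "n \<in> A") auto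
      qed
      also have "\<dots> \<le> 3 * W N" using elim by (simp add: sum.distrib pos_divide_less_eq)
      finally show ?case using elim by simp
    qed
  qed
  define S where "S = r ` A"
  have infA: "infinite A" using Wlim A1 by (rule infinite_selection)
  have enum: "enumerate S k = r (enumerate A k)" for k
  proof -
    have "enumerate S = (\<lambda>k. r (enumerate A k))"
    proof (rule enumerate_eqI)
      show "strict_mono (\<lambda>k. r (enumerate A k))"
        using sm strict_mono_enumerate[OF infA] by (simp add: strict_mono_def)
      show "range (\<lambda>k. r (enumerate A k)) = S"
        unfolding S_def using image_image[of r "enumerate A" UNIV] range_enumerate[OF infA] by simp
    qed
    then show ?thesis by simp
  qed
  have sel: "(\<lambda>K. (\<Sum>k<K. c (enumerate A k)) / of_nat K) \<longlonglongrightarrow> l"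
    if "(\<lambda>N. (\<Sum>n<N. of_real (p n) * c n) / of_real (W N)) \<longlonglongrightarrow> l"
      "(\<lambda>N. (\<Sum>n<N. of_real (indicator A n - p n) * c n) / of_real (W N)) \<longlonglongrightarrow> 0" for c :: "nat \<Rightarrow> complex" and l
  proof (rule selected_average[OF Wlim A1])
    show "(\<lambda>N. (\<Sum>n<N. of_real (indicator A n) * c n) / of_real (W N)) \<longlonglongrightarrow> l"
      using tendsto_add[OF that] by (simp add: sum_subtractf left_diff_distrib diff_divide_distrib)
  qed
  have good: "good_set S"
    unfolding good_set_def
  proof (intro conjI allI)
    show "infinite S" unfolding S_def using infA sm by (simp add: finite_image_iff strict_mono_imp_inj_on)
    show "0 \<notin> S" unfolding S_def using r1 by (metis imageE not_one_le_zero)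
    fix \<beta> :: real
    have "\<forall>j. \<exists>l. (\<lambda>N. (\<Sum>n<N. of_real (b j n) * echar (real (r n) * \<beta>)) / of_nat N) \<longlonglongrightarrow> l"
      using twisted_average[OF assms(1) \<rho>(2)] unfolding convergent_def b_def x_def r_def by blast
    then obtain L where "\<And>j. (\<lambda>N. (\<Sum>n<N. of_real (b j n) * echar (real (r n) * \<beta>)) / of_nat N) \<longlonglongrightarrow> L j"
      by metis
    then obtain l where "(\<lambda>N. (\<Sum>n<N. of_real (p n) * echar (real (r n) * \<beta>)) / of_real (W N)) \<longlonglongrightarrow> l"
      using diag[of "\<lambda>n. echar (real (r n) * \<beta>)" 1 L] by auto
    from sel[OF this disc]
    show "convergent (\<lambda>N. (\<Sum>n<N. echar (real (enumerate S n) * \<beta>)) / of_nat N)"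
      unfolding convergent_def enum by blast
  qed
  have wl: "weak_limit (empirical S \<alpha>) \<nu>"
    unfolding weak_limit_def
  proof (intro allI impI)
    fix f :: "circle \<Rightarrow> real" assume f: "continuous_on UNIV f"
    have "(\<lambda>N. (\<Sum>n<N. of_real (indicator A n - p n) * of_real (f (x n))) / complex_of_real (W N)) \<longlonglongrightarrow> 0"
      unfolding x_def using disc f bound by (rule selection_continuous)
    from sel[OF cont[OF f] this]
    have "(\<lambda>K. complex_of_real ((\<Sum>k<K. f (x (enumerate A k))) / real K)) \<longlonglongrightarrow> complex_of_real (\<integral>x. f x \<partial>\<nu>)"
      by simp
    then have "(\<lambda>K. (\<Sum>k<K. f (x (enumerate A k))) / real K) \<longlonglongrightarrow> (\<integral>x. f x \<partial>\<nu>)"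
      unfolding tendsto_of_real_iff .
    then show "(\<lambda>N. \<integral>x. f x \<partial>empirical S \<alpha> N) \<longlonglongrightarrow> (\<integral>x. f x \<partial>\<nu>)"
      unfolding integral_empirical[OF f] enum x_def .
  qed
  have "mu S \<alpha> = \<nu>"
    unfolding mu_def using ex1_limit_measure[OF good, of \<alpha>] assms(4,5) wl by (intro the1_equality) auto
  moreover have "S \<subseteq> R" unfolding S_def using rR by blast
  ultimately show ?thesis using good by blast
qed

end
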